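(* Let $A, B \in L(\mathcal{H})$ have closed ranges and let $W \in L(\mathcal{H})^+$ be such that $N(B)=R(A)^{\perp_W}$. Then the shorted operator $W_{/R(A)}$ is a lower bound, with respect to the minus order $\overset{-}{\leq}$, of the set $\{(AXB-I)^*W(AXB-I) : X \in L(\mathcal{H})\}$ if and only if the pair $(W, N(W_{/R(A)}))$ is compatible. In this case, if $R(A)+R(A)^{\perp_W}$ is closed, then $$W_{/R(A)} = \inf_{\overset{-}{\leq}}\ \{(AXB-I)^*W(AXB-I) : X\in L(\mathcal{H})\},$$ i.e. $W_{/R(A)}$ is the greatest lower bound of this set with respect to the minus order on $L(\mathcal{H})$.
   Context: $\mathcal{H}$ is a separable complex Hilbert space, $L(\mathcal{H})$ the algebra of bounded linear operators on $\mathcal{H}$, $L(\mathcal{H})^+$ the cone of positive semidefinite operators, and $\leq$ the order induced by this cone. $R(T)$ and $N(T)$ denote range and nullspace of $T$. For a subspace $\mathcal{S}$, $\mathcal{S}^{\perp_W}=\{x\in\mathcal{H}: \langle Wx,y\rangle=0 \text{ for all } y\in\mathcal{S}\}=W^{-1}(\mathcal{S}^\perp)$. Shorted operator: for a closed subspace $\mathcal{S}$, $W_{/\mathcal{S}}$ is the maximum, with respect to $\leq$ (known to exist), of $\{X\in L(\mathcal{H}): 0\leq X\leq W,\ R(X)\subseteq \mathcal{S}^\perp\}$. Compatibility: the pair $(W,\mathcal{T})$, with $\mathcal{T}$ a closed subspace, is compatible if there exists $Q\in L(\mathcal{H})$ with $Q^2=Q$, $R(Q)=\mathcal{T}$ and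 $WQ=Q^*W$. Minus order: for $C,D\in L(\mathcal{H})$, $C \overset{-}{\leq} D$ means that there exist (oblique) projections $P,Q\in L(\mathcal{H})$ (i.e. $P^2=P$, $Q^2=Q$) such that $C=PD$ and $C^*=QD^*$. This is a partial order on $L(\mathcal{H})$. *)

theory Defs
  imports "HOL-Analysis.Analysis"
begin

section \<open>Complex Hilbert spaces\<close>

text \<open>
  A complex Hilbert space is a \<^class>\<open>real_inner\<close> space, complete for its norm, together with
  a complex scalar multiplication extending the real one and a sesquilinear form (linear in the
  first argument) whose real part is the given real inner product. Norm and topology are therefore
  those of HOL-Analysis, with \<open>(norm x)\<^sup>2 = cinner x x\<close>.
\<close>

class complex_vector = real_vector +
  fixes scaleC :: "complex \<Rightarrow> 'a \<Rightarrow> 'a"  (infixr "*\<^sub>C" 75)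
  assumes scaleC_add_right: "c *\<^sub>C (x + y) = c *\<^sub>C x + c *\<^sub>C y"
    and scaleC_add_left: "(c + d) *\<^sub>C x = c *\<^sub>C x + d *\<^sub>C x"
    and scaleC_scaleC: "c *\<^sub>C d *\<^sub>C x = (c * d) *\<^sub>C x"
    and scaleC_of_real: "complex_of_real r *\<^sub>C x = r *\<^sub>R x"

class complex_inner = complex_vector + real_inner +
  fixes cinner :: "'a \<Rightarrow> 'a \<Rightarrow> complex"
  assumes cinner_commute: "cinner x y = cnj (cinner y x)"
    and cinner_add_left: "cinner (x + y) z = cinner x z + cinner y z"
    and cinner_scaleC_left: "cinner (c *\<^sub>C x) y = c * cinner x y"
    and Re_cinner: "Re (cinner x y) = inner x y"

class complex_hilbert_space = complex_inner + complete_space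

instantiation complex :: complex_hilbert_space
begin

definition scaleC_complex :: "complex \<Rightarrow> complex \<Rightarrow> complex"
  where "scaleC_complex c x = c * x"

definition cinner_complex :: "complex \<Rightarrow> complex \<Rightarrow> complex"
  where "cinner_complex x y = x * cnj y"

instance
  by standard
    (simp_all add: scaleC_complex_def cinner_complex_def algebra_simps inner_complex_def
      scaleR_conv_of_real)

end


section \<open>Bounded operators\<close>

definition bounded_clinear :: "('a::complex_hilbert_space \<Rightarrow> 'a) \<Rightarrow> bool"
  where "bounded_clinear T \<longleftrightarrow> bounded_linear T \<and> (\<forall>c x. T (c *\<^sub>C x) = c *\<^sub>C T x)"

text \<open>
  For a bounded operator the adjoint exists and is unique by the Riesz representation theorem. (The
  library's \<^const>\<open>adjoint\<close> is the adjoint for the real inner product.)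
\<close>

definition adj :: "('a::complex_hilbert_space \<Rightarrow> 'a) \<Rightarrow> 'a \<Rightarrow> 'a"
  where "adj T = (THE S. \<forall>x y. cinner (T x) y = cinner x (S y))"

definition nullspace :: "('a::complex_hilbert_space \<Rightarrow> 'a) \<Rightarrow> 'a set"
  where "nullspace T = {x. T x = 0}"

definition projection :: "('a::complex_hilbert_space \<Rightarrow> 'a) \<Rightarrow> bool"
  where "projection P \<longleftrightarrow> bounded_clinear P \<and> P \<circ> P = P"

text \<open>Membership in \<open>\<real>\<^sub>\<ge>\<^sub>0\<close> says that the complex number is real and nonnegative.\<close>

definition positive_op :: "('a::complex_hilbert_space \<Rightarrow> 'a) \<Rightarrow> bool"
  where "positive_op T \<longleftrightarrow> bounded_clinear T \<and> (\<forall>x. cinner (T x) x \<in> \<real>\<^sub>\<ge>\<^sub>0)"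

definition op_le :: "('a::complex_hilbert_space \<Rightarrow> 'a) \<Rightarrow> ('a \<Rightarrow> 'a) \<Rightarrow> bool"
  where "op_le S T \<longleftrightarrow> positive_op (\<lambda>x. T x - S x)"


section \<open>Orthogonality, shorted operators, compatibility\<close>

definition ortho :: "'a::complex_hilbert_space set \<Rightarrow> 'a set"
  where "ortho S = {x. \<forall>y\<in>S. cinner x y = 0}"

definition ortho_wrt :: "('a::complex_hilbert_space \<Rightarrow> 'a) \<Rightarrow> 'a set \<Rightarrow> 'a set"
  where "ortho_wrt W S = {x. \<forall>y\<in>S. cinner (W x) y = 0}"

definition shorted_candidates :: "('a::complex_hilbert_space \<Rightarrow> 'a) \<Rightarrow> 'a set \<Rightarrow> ('a \<Rightarrow> 'a) set"
  where "shorted_candidates W S =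
    {X. bounded_clinear X \<and> op_le (\<lambda>x. 0) X \<and> op_le X W \<and> range X \<subseteq> ortho S}"

text \<open>
  The maximum exists whenever \<open>W\<close> is positive and \<open>S\<close> is a closed subspace; it is unique because
  \<^const>\<open>op_le\<close> is antisymmetric.
\<close>

definition shorted :: "('a::complex_hilbert_space \<Rightarrow> 'a) \<Rightarrow> 'a set \<Rightarrow> 'a \<Rightarrow> 'a"
  where "shorted W S =
    (THE X. X \<in> shorted_candidates W S \<and> (\<forall>Y \<in> shorted_candidates W S. op_le Y X))"

text \<open>A set of the form \<open>range Q\<close> with \<open>Q\<close> a projection is automatically a closed subspace.\<close>

definition compatible :: "('a::complex_hilbert_space \<Rightarrow> 'a) \<Rightarrow> 'a set \<Rightarrow> bool"
  where "compatible W S \<longleftrightarrow> (\<exists>Q. projection Q \<and> range Q = S \<and> W \<circ> Q = adj Q \<circ> W)"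


section \<open>The minus order\<close>

definition minus_le :: "('a::complex_hilbert_space \<Rightarrow> 'a) \<Rightarrow> ('a \<Rightarrow> 'a) \<Rightarrow> bool"
  where "minus_le C D \<longleftrightarrow>
    (\<exists>P Q. projection P \<and> projection Q \<and> C = P \<circ> D \<and> adj C = Q \<circ> adj D)"

definition minus_lower_bound :: "('a::complex_hilbert_space \<Rightarrow> 'a) \<Rightarrow> ('a \<Rightarrow> 'a) set \<Rightarrow> bool"
  where "minus_lower_bound C M \<longleftrightarrow> bounded_clinear C \<and> (\<forall>D\<in>M. minus_le C D)"

definition is_minus_inf :: "('a::complex_hilbert_space \<Rightarrow> 'a) \<Rightarrow> ('a \<Rightarrow> 'a) set \<Rightarrow> bool"
  where "is_minus_inf C M \<longleftrightarrow>
    minus_lower_bound C M \<and> (\<forall>Y. minus_lower_bound Y M \<longrightarrow> minus_le Y C)"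

definition weighted_residuals ::
    "('a::complex_hilbert_space \<Rightarrow> 'a) \<Rightarrow> ('a \<Rightarrow> 'a) \<Rightarrow> ('a \<Rightarrow> 'a) \<Rightarrow> ('a \<Rightarrow> 'a) set"
  where "weighted_residuals A B W =
    {adj (\<lambda>h. A (X (B h)) - h) \<circ> W \<circ> (\<lambda>h. A (X (B h)) - h) | X. bounded_clinear X}"

end

theory Submission
  imports Defs
begin

text \<open>
  Write \<open>S = range A\<close>, let \<open>Z\<close> be the shorted operator of \<open>W\<close> to \<open>S\<close>, and let
  \<open>D X = (A X B - I)\<^sup>* W (A X B - I)\<close>.

  The hypothesis \<open>nullspace B = ortho_wrt W S\<close> makes all \<open>D X\<close> agree with \<open>Z\<close> on \<open>nullspace B\<close>
  (\<open>weighted_residual_on_nullspace\<close>): there \<open>A X B - I\<close> acts as \<open>- I\<close>, and \<open>W\<close> agrees with \<open>Z\<close> on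
  the \<open>W\<close>-orthogonal complement of \<open>S\<close>. If \<open>Q\<close> witnesses the compatibility of \<open>W\<close> and
  \<open>nullspace Z\<close>, then \<open>F = I - Q\<close> maps into \<open>nullspace B\<close>, so \<open>D X F = Z F = Z\<close> and, taking adjoints,
  \<open>Z = F\<^sup>* (D X)\<close>. Thus \<open>Z\<close> is a lower bound. Conversely, the single relation \<open>Z \<le> W\<close> in the minus
  order, \<open>W\<close> being \<open>D 0\<close>, already forces compatibility: \<open>Z = P W\<close> gives \<open>Z = W P\<^sup>*\<close>, and \<open>I - P\<^sup>*\<close>
  is the required projection after a correction inside \<open>nullspace W\<close>
  (\<open>minus_le_weight_imp_compatible\<close>).

  For the infimum let \<open>Y\<close> be a lower bound. If \<open>S + nullspace B\<close> is closed, then \<open>B A\<close> has closed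
  range, and a generalized inverse \<open>X\<close> of it makes \<open>D X\<close> vanish on \<open>S\<close>
  (\<open>optimal_residual_exists\<close>). Hence \<open>Y\<close> and \<open>Y\<^sup>*\<close> vanish on \<open>S\<close>. Being below \<open>W\<close> they also have
  their ranges in \<open>range W\<close>, hence in \<open>W (ortho_wrt W S) \<subseteq> range Z\<close>, and so both of them vanish on
  \<open>nullspace Z\<close> (\<open>nullspace_shorted_subset\<close>). Then \<open>Y = P W\<close> implies \<open>Y = Y F = P W F = P Z\<close>, and
  similarly for \<open>Y\<^sup>*\<close>.

  The analytic facts behind this are built from one construction. For positive \<open>W\<close> and a
  subspace \<open>S\<close>, the vectors \<open>W (x + s)\<close>, with \<open>s\<close> in \<open>S\<close> nearly minimizing the form of \<open>W\<close> at
  \<open>x + s\<close>, converge; the limit as a function of \<open>x\<close> is the shorted operator, which moreover equals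
  \<open>W\<close> on \<open>ortho_wrt W S\<close>. No square root of \<open>W\<close> is taken. For \<open>W = I\<close> the same construction is
  the projection theorem, from which adjoints follow. Generalized inverses use in addition
  the open mapping theorem for operators with closed range.
\<close>

section \<open>Operators with closed range between Banach spaces\<close>

text \<open>
  Baire category on the complete space \<open>range T\<close>: it is the union of the closures of the images of
  the balls of integer radius, so one of these closures has interior. Differences and scaling move
  that interior to the origin, which gives preimages of controlled norm, but only up to a small
  error. The error is stated as half the norm so that it can be iterated away.
\<close>

lemma closed_range_approx_preimage:
  fixes T :: "'a::banach \<Rightarrow> 'b::banach"
  assumes T: "bounded_linear T" and cl: "closed (range T)"
  obtains K where "K > 0"
    "\<And>y. y \<in> range T \<Longrightarrow> \<exists>x. norm x \<le> K * norm y \<and> norm (y - T x) \<le> norm y / 2"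
proof -
  interpret T: bounded_linear T by fact
  let ?F = "\<lambda>n::nat. closure (T ` ball 0 (real n))"
  let ?X = "top_of_set (range T)"
  have sub: "?F n \<subseteq> range T" for n
    by (rule closure_minimal[OF _ cl]) auto
  have "\<Union>(range ?F) = range T"
  proof
    show "range T \<subseteq> \<Union>(range ?F)"
    proof
      fix y assume "y \<in> range T"
      then obtain x where y: "y = T x" by blast
      obtain n where "norm x < real n" using reals_Archimedean2 by blast
      then have "y \<in> T ` ball 0 (real n)" using y by auto
      then have "y \<in> ?F n" by (rule subsetD[OF closure_subset])
      then show "y \<in> \<Union>(range ?F)" by (rule UN_I[OF UNIV_I])
    qed
  qed (use sub in blast)
  then have ne: "?X interior_of \<Union>(range ?F) \<noteq> {}"
    using interior_of_topspace[of ?X] by simp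
  have "completely_metrizable_space ?X"
    by (rule completely_metrizable_space_closedin[OF completely_metrizable_space_euclidean])
      (use cl in simp)
  then have "\<exists>n. \<not> (closedin ?X (?F n) \<and> ?X interior_of (?F n) = {})"
    using ne Baire_category_alt[of ?X "range ?F"] by auto
  moreover have "closedin ?X (?F n)" for n
    using sub by (simp add: closed_subset)
  ultimately obtain n y0 where "y0 \<in> ?X interior_of (?F n)" by blast
  then obtain U where U: "openin ?X U" "y0 \<in> U" "U \<subseteq> ?F n"
    by (auto simp: interior_of_def)
  then obtain r where r: "r > 0" "ball y0 r \<inter> range T \<subseteq> ?F n"
    by (meson openin_contains_ball subset_trans)
  have y0: "y0 \<in> range T" using U sub by blast
  have near: "\<exists>x. norm x \<le> real n \<and> norm (y - T x) < e" if "y \<in> ?F n" "e > 0" for y e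
  proof -
    obtain x where "norm x < real n" "dist (T x) y < e"
      using \<open>y \<in> ?F n\<close> \<open>e > 0\<close> by (auto simp: closure_approachable)
    then show ?thesis by (intro exI[of _ x]) (simp add: dist_norm norm_minus_commute)
  qed
  have small: "\<exists>x. norm x \<le> 2 * real n \<and> norm (y - T x) < e"
    if y: "y \<in> range T" "norm y < r" and e: "e > 0" for y e
  proof -
    \<comment> \<open>Both ends of the difference \<open>y = (y0 + y) - y0\<close> lie in \<open>?F n\<close>.\<close>
    have "y0 + y \<in> ball y0 r" using y by (simp add: dist_norm)
    moreover have "y0 + y \<in> range T"
      using y0 y(1) by (auto simp: T.add[symmetric])
    ultimately have 1: "y0 + y \<in> ?F n" using r by blast
    have 2: "y0 \<in> ?F n" using U by blast
    obtain a b where a: "norm a \<le> real n" "norm (y0 + y - T a) < e/2"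
      and b: "norm b \<le> real n" "norm (y0 - T b) < e/2"
      using near[OF 1, of "e/2"] near[OF 2, of "e/2"] e by auto
    have "y - T (a - b) = (y0 + y - T a) - (y0 - T b)" by (simp add: T.diff)
    also have "norm \<dots> \<le> norm (y0 + y - T a) + norm (y0 - T b)"
      by (rule norm_triangle_ineq4)
    also have "\<dots> < e/2 + e/2" by (rule add_strict_mono[OF a(2) b(2)])
    finally have "norm (y - T (a - b)) < e" by simp
    moreover have "norm (a - b) \<le> 2 * real n"
      using a b norm_triangle_ineq4[of a b] by linarith
    ultimately show ?thesis by blast
  qed
  define K where "K = 4 * real n / r + 1"
  have "\<exists>x. norm x \<le> K * norm y \<and> norm (y - T x) \<le> norm y / 2" if y: "y \<in> range T" for y
  proof (cases "y = 0")
    case True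
    then show ?thesis by (intro exI[of _ 0]) (simp add: T.zero)
  next
    case False
    define c where "c = r / (2 * norm y)"
    have c: "c > 0" using r False by (simp add: c_def)
    have "c *\<^sub>R y \<in> range T" using y by (auto simp: T.scaleR[symmetric])
    moreover have "norm (c *\<^sub>R y) < r" using r False by (simp add: c_def)
    ultimately obtain x where x: "norm x \<le> 2 * real n" "norm (c *\<^sub>R y - T x) < c * norm y / 2"
      using small[of "c *\<^sub>R y" "c * norm y / 2"] c False by auto
    have "y - T (x /\<^sub>R c) = (c *\<^sub>R y - T x) /\<^sub>R c"
      using c by (simp add: T.scaleR algebra_simps)
    then have "norm (y - T (x /\<^sub>R c)) = norm (c *\<^sub>R y - T x) / c"
      using c by (simp add: divide_inverse mult.commute)
    also have "\<dots> \<le> (c * norm y / 2) / c"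
      using x c by (intro divide_right_mono) auto
    also have "\<dots> = norm y / 2" using c by simp
    finally have 1: "norm (y - T (x /\<^sub>R c)) \<le> norm y / 2" .
    have "norm (x /\<^sub>R c) = norm x / c" using c by (simp add: divide_inverse mult.commute)
    also have "\<dots> \<le> 2 * real n / c" using x c by (intro divide_right_mono) auto
    also have "\<dots> \<le> K * norm y" using r False by (simp add: c_def K_def field_simps)
    finally show ?thesis using 1 by blast
  qed
  moreover have "K > 0" using r by (simp add: K_def add_nonneg_pos)
  ultimately show ?thesis using that by blast
qed

text \<open>
  The open mapping theorem for an operator with closed range. Feeding the error of each approximate
  preimage back in produces errors that halve at every step, so the corrections form an absolutely
  convergent series whose sum is an exact preimage.
\<close>

lemma closed_range_bounded_preimage:
  fixes T :: "'a::banach \<Rightarrow> 'b::banach"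
  assumes T: "bounded_linear T" and cl: "closed (range T)"
  obtains K where "K > 0" "\<And>y. y \<in> range T \<Longrightarrow> \<exists>x. T x = y \<and> norm x \<le> K * norm y"
proof -
  interpret T: bounded_linear T by fact
  obtain K where K: "K > 0"
    "\<And>y. y \<in> range T \<Longrightarrow> \<exists>x. norm x \<le> K * norm y \<and> norm (y - T x) \<le> norm y / 2"
    using closed_range_approx_preimage[OF assms] by blast
  then obtain g where g: "\<And>y. y \<in> range T \<Longrightarrow> norm (g y) \<le> K * norm y"
    "\<And>y. y \<in> range T \<Longrightarrow> norm (y - T (g y)) \<le> norm y / 2"
    by metis
  have "\<exists>x. T x = y \<and> norm x \<le> 2 * K * norm y" if y: "y \<in> range T" for y
  proof -
    define r where "r k = ((\<lambda>z. z - T (g z)) ^^ k) y" for k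
    have rS: "r (Suc k) = r k - T (g (r k))" for k by (simp add: r_def)
    have rR: "r k \<in> range T" for k
    proof (induction k)
      case (Suc k)
      then obtain x where "r k = T x" by blast
      then have "r (Suc k) = T (x - g (r k))" by (simp add: rS T.diff)
      then show ?case by blast
    qed (simp add: r_def y)
    have rn: "norm (r k) \<le> norm y * (1/2)^k" for k
    proof (induction k)
      case (Suc k)
      have "norm (r (Suc k)) \<le> norm (r k) / 2" using g(2)[OF rR] rS by metis
      then show ?case using Suc by simp
    qed (simp add: r_def)
    have gn: "norm (g (r k)) \<le> K * norm y * (1/2)^k" for k
      using order_trans[OF g(1)[OF rR] mult_left_mono[OF rn]] K(1) by (simp add: mult.assoc)
    have gs: "(\<lambda>k. K * norm y * (1/2)^k) sums (K * norm y * 2)"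
      using sums_mult[OF geometric_sums[of "1/2::real"], of "K * norm y"] by simp
    have sn: "summable (\<lambda>k. norm (g (r k)))"
      by (rule summable_comparison_test'[OF sums_summable[OF gs], of 0]) (use gn in auto)
    then have s: "summable (\<lambda>k. g (r k))" by (rule summable_norm_cancel)
    have "norm (\<Sum>k. g (r k)) \<le> (\<Sum>k. norm (g (r k)))" by (rule summable_norm[OF sn])
    also have "\<dots> \<le> K * norm y * 2"
      using suminf_le[OF gn sn sums_summable[OF gs]] sums_unique[OF gs] by simp
    finally have 1: "norm (\<Sum>k. g (r k)) \<le> 2 * K * norm y" by (simp add: mult_ac)
    have "r \<longlonglongrightarrow> 0"
    proof (rule Lim_null_comparison[of _ "\<lambda>k. norm y * (1/2)^k"])
      show "(\<lambda>k. norm y * (1/2)^k) \<longlonglongrightarrow> 0"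
        by (intro tendsto_mult_right_zero LIMSEQ_power_zero) simp
    qed (simp add: rn)
    then have "(\<lambda>k. r k - r (Suc k)) sums (r 0 - 0)" by (rule telescope_sums')
    moreover have "r k - r (Suc k) = T (g (r k))" for k by (simp add: rS)
    ultimately have "(\<lambda>k. T (g (r k))) sums y" by (simp add: r_def)
    moreover have "(\<lambda>k. T (g (r k))) sums T (\<Sum>k. g (r k))"
      by (rule T.sums[OF summable_sums[OF s]])
    ultimately have "T (\<Sum>k. g (r k)) = y" using sums_unique2 by blast
    then show ?thesis using 1 by blast
  qed
  then show ?thesis using that[of "2 * K"] K(1) by auto
qed

section \<open>Complex inner products and bounded operators\<close>

instance complex_hilbert_space \<subseteq> banach ..

lemma scaleC_eq: "c *\<^sub>C x = Re c *\<^sub>R x + Im c *\<^sub>R (\<i> *\<^sub>C x)"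
proof -
  have "c = complex_of_real (Re c) + complex_of_real (Im c) * \<i>"
    by (simp add: complex_eq_iff)
  then have "c *\<^sub>C x = (complex_of_real (Re c) + complex_of_real (Im c) * \<i>) *\<^sub>C x" by simp
  then show ?thesis
    by (simp only: scaleC_add_left scaleC_scaleC[symmetric] scaleC_of_real)
qed

lemma scaleC_neg_one: "(-1) *\<^sub>C x = - x"
  using scaleC_of_real[of "-1" x] by simp

lemma scaleC_ii: "\<i> *\<^sub>C \<i> *\<^sub>C x = - x"
  by (simp add: scaleC_scaleC scaleC_neg_one)

lemma scaleC_zero_right [simp]: "c *\<^sub>C 0 = 0"
  using scaleC_add_right[of c 0 0] by simp

lemma scaleC_minus_right: "c *\<^sub>C (- x) = - (c *\<^sub>C x)"
  using scaleC_add_right[of c x "- x"] by (simp add: eq_neg_iff_add_eq_0 add.commute)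

lemma scaleC_diff_right: "c *\<^sub>C (x - y) = c *\<^sub>C x - c *\<^sub>C y"
  using scaleC_add_right[of c x "- y"] by (simp add: scaleC_minus_right)

lemma cinner_zero_left [simp]: "cinner 0 y = 0"
  using cinner_add_left[of 0 0 y] by simp

lemma cinner_minus_left: "cinner (- x) y = - cinner x y"
  using cinner_add_left[of x "- x" y] by (simp add: eq_neg_iff_add_eq_0 add.commute)

lemma cinner_diff_left: "cinner (x - y) z = cinner x z - cinner y z"
  using cinner_add_left[of x "- y" z] by (simp add: cinner_minus_left)

lemma cinner_add_right: "cinner x (y + z) = cinner x y + cinner x z"
  by (metis cinner_add_left cinner_commute complex_cnj_add)

lemma cinner_diff_right: "cinner x (y - z) = cinner x y - cinner x z"
  by (metis cinner_diff_left cinner_commute complex_cnj_diff)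

lemma cinner_scaleC_right: "cinner x (c *\<^sub>C y) = cnj c * cinner x y"
  by (metis cinner_commute cinner_scaleC_left complex_cnj_mult)

lemma cinner_zero_right [simp]: "cinner x 0 = 0"
  using cinner_add_right[of x 0 0] by simp

lemma cinner_minus_right: "cinner x (- y) = - cinner x y"
  using cinner_diff_right[of x 0 y] by simp

text \<open>
  The complex inner product is recovered from the real one. Below, inequalities, limits and
  symmetry are handled with \<^const>\<open>inner\<close>, and this identity together with invariance under
  multiplication by \<open>\<i>\<close> returns to \<^const>\<open>cinner\<close>.
\<close>

lemma cinner_eq: "cinner x y = Complex (inner x y) (inner x (\<i> *\<^sub>C y))"
proof -
  have "Re (cinner x (\<i> *\<^sub>C y)) = Im (cinner x y)" by (simp add: cinner_scaleC_right)
  then show ?thesis by (simp add: complex_eq_iff Re_cinner)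
qed

lemma inner_ii: "inner (\<i> *\<^sub>C (x::'a::complex_inner)) y = - inner x (\<i> *\<^sub>C y)"
  by (simp add: Re_cinner[symmetric] cinner_scaleC_left cinner_scaleC_right)

lemma cinner_self: "cinner x x = complex_of_real (inner x x)"
proof -
  have "Im (cinner x x) = - Im (cinner x x)"
    by (metis cinner_commute cnj.sel(2))
  then show ?thesis by (simp add: complex_eq_iff Re_cinner)
qed

lemma eq_zero_if_cinner: "(\<And>y. cinner x y = 0) \<Longrightarrow> x = 0"
  by (metis Re_cinner inner_eq_zero_iff zero_complex.sel(1))

definition csubspace :: "'a::complex_hilbert_space set \<Rightarrow> bool"
  where "csubspace S \<longleftrightarrow> subspace S \<and> (\<forall>x\<in>S. \<i> *\<^sub>C x \<in> S)"

lemma csubspaceD: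
  assumes "csubspace S"
  shows "0 \<in> S" "x \<in> S \<Longrightarrow> y \<in> S \<Longrightarrow> x + y \<in> S" "x \<in> S \<Longrightarrow> y \<in> S \<Longrightarrow> x - y \<in> S"
    "x \<in> S \<Longrightarrow> r *\<^sub>R x \<in> S" "x \<in> S \<Longrightarrow> \<i> *\<^sub>C x \<in> S" "x \<in> S \<Longrightarrow> - x \<in> S"
  using assms
  by (auto simp: csubspace_def subspace_add subspace_diff subspace_scale subspace_neg subspace_0)

lemma ortho_iff_inner: "csubspace S \<Longrightarrow> x \<in> ortho S \<longleftrightarrow> (\<forall>y\<in>S. inner x y = 0)"
  by (auto simp: ortho_def cinner_eq complex_eq_iff csubspaceD)

lemma ortho_wrt_iff: "x \<in> ortho_wrt W S \<longleftrightarrow> W x \<in> ortho S"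
  by (simp add: ortho_wrt_def ortho_def)

lemma csubspace_ortho: "csubspace (ortho S)"
  unfolding csubspace_def subspace_def ortho_def
  by (auto simp: cinner_add_left cinner_scaleC_left scaleC_of_real[symmetric])

lemma bounded_clinearI:
  assumes "bounded_linear T" "\<And>x. T (\<i> *\<^sub>C x) = \<i> *\<^sub>C T x"
  shows "bounded_clinear T"
proof -
  interpret bounded_linear T by fact
  show ?thesis
    unfolding bounded_clinear_def using assms
    by (metis add scale scaleC_eq)
qed

lemma bounded_clinear_bl: "bounded_clinear T \<Longrightarrow> bounded_linear T"
  by (simp add: bounded_clinear_def)

lemma bounded_clinear_scaleC: "bounded_clinear T \<Longrightarrow> T (c *\<^sub>C x) = c *\<^sub>C T x"
  by (simp add: bounded_clinear_def)

lemma bounded_clinear_simps: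
  assumes "bounded_clinear T"
  shows "T (x + y) = T x + T y" "T (x - y) = T x - T y" "T (- x) = - T x" "T 0 = 0"
    "T (r *\<^sub>R x) = r *\<^sub>R T x" "T (c *\<^sub>C x) = c *\<^sub>C T x"
proof -
  interpret bounded_linear T using assms by (rule bounded_clinear_bl)
  show "T (x + y) = T x + T y" "T (x - y) = T x - T y" "T (- x) = - T x" "T 0 = 0"
    "T (r *\<^sub>R x) = r *\<^sub>R T x"
    by (rule add diff neg zero scale)+
  show "T (c *\<^sub>C x) = c *\<^sub>C T x" using assms by (rule bounded_clinear_scaleC)
qed

lemma bounded_clinear_compose:
  "bounded_clinear T \<Longrightarrow> bounded_clinear U \<Longrightarrow> bounded_clinear (\<lambda>x. T (U x))"
  by (auto simp: bounded_clinear_def intro: bounded_linear_compose)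

lemma bounded_clinear_diff:
  "bounded_clinear T \<Longrightarrow> bounded_clinear U \<Longrightarrow> bounded_clinear (\<lambda>x. T x - U x)"
  by (auto simp: bounded_clinear_def scaleC_diff_right intro: bounded_linear_sub)

lemma bounded_clinear_ident: "bounded_clinear (\<lambda>x. x)"
  by (simp add: bounded_clinear_def bounded_linear_ident)

lemma bounded_clinear_zero: "bounded_clinear (\<lambda>x. 0)"
  by (simp add: bounded_clinear_def bounded_linear_zero)

lemma nullspace_iff: "x \<in> nullspace T \<longleftrightarrow> T x = 0"
  by (simp add: nullspace_def)

lemma csubspace_range: "bounded_clinear T \<Longrightarrow> csubspace (range T)"
  unfolding csubspace_def
  by (auto simp: bounded_clinear_scaleC[symmetric]
      intro!: linear_subspace_image[OF bounded_linear.linear[OF bounded_clinear_bl] subspace_UNIV])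

lemma csubspace_nullspace: "bounded_clinear T \<Longrightarrow> csubspace (nullspace T)"
  unfolding csubspace_def subspace_def nullspace_def by (auto simp: bounded_clinear_simps)

lemma closed_nullspace: "bounded_clinear T \<Longrightarrow> closed (nullspace T)"
  unfolding nullspace_def
  by (intro closed_Collect_eq continuous_on_const linear_continuous_on bounded_clinear_bl)

section \<open>The seminorm of a positive operator\<close>

lemma positive_op_clinear: "positive_op W \<Longrightarrow> bounded_clinear W"
  by (simp add: positive_op_def)

lemma positive_op_nonneg: "positive_op W \<Longrightarrow> 0 \<le> inner (W x) x"
  by (metis Re_cinner complex_nonneg_Reals_iff positive_op_def)

text \<open>
  Polarization: that \<open>cinner (W z) z\<close> is real for every \<open>z\<close> makes \<open>inner (W x) (\<i> *\<^sub>C y)\<close>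
  antisymmetric in \<open>x\<close> and \<open>y\<close>, and replacing \<open>y\<close> by \<open>- \<i> *\<^sub>C y\<close> turns this into symmetry.
\<close>

lemma positive_op_sym:
  assumes W: "positive_op W"
  shows "inner (W x) y = inner x (W y)"
proof -
  note lin = bounded_clinear_simps[OF positive_op_clinear[OF W]]
  have 0: "inner (W z) (\<i> *\<^sub>C z) = 0" for z
    using W by (simp add: positive_op_def cinner_eq complex_nonneg_Reals_iff)
  have "inner (W x) (\<i> *\<^sub>C y) + inner (W y) (\<i> *\<^sub>C x) = 0" for x y
    using 0[of "x + y"] 0[of x] 0[of y]
    by (simp add: lin scaleC_add_right inner_add_left inner_add_right)
  from this[of x "- (\<i> *\<^sub>C y)"] show ?thesis
    by (simp add: lin scaleC_minus_right scaleC_ii inner_ii inner_commute)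
qed

lemma positive_opI:
  assumes T: "bounded_clinear T" and sym: "\<And>x y. inner (T x) y = inner x (T y)"
    and pos: "\<And>x. 0 \<le> inner (T x) x"
  shows "positive_op T"
proof -
  have "inner (T x) (\<i> *\<^sub>C x) = 0" for x
  proof -
    have "inner (T x) (\<i> *\<^sub>C x) = inner x (\<i> *\<^sub>C T x)"
      using T by (simp add: sym bounded_clinear_simps)
    also have "\<dots> = - inner (T x) (\<i> *\<^sub>C x)"
      by (metis inner_commute inner_ii)
    finally show ?thesis by simp
  qed
  then show ?thesis
    using T pos by (simp add: positive_op_def cinner_eq complex_nonneg_Reals_iff)
qed

lemma positive_op_ident: "positive_op (\<lambda>x. x)"
  by (rule positive_opI) (auto simp: bounded_clinear_ident)

lemma positive_op_csym:
  assumes W: "positive_op W"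
  shows "cinner (W x) y = cinner x (W y)"
  using positive_op_sym[OF W, of x y] positive_op_sym[OF W, of x "\<i> *\<^sub>C y"]
  by (simp add: cinner_eq bounded_clinear_simps[OF positive_op_clinear[OF W]])

text \<open>
  The seminorm of the positive form defined by \<open>W\<close>; in the usual notation it is
  \<open>\<parallel>W\<^sup>1\<^sup>/\<^sup>2 x\<parallel>\<close>, and it stands in for the square root of \<open>W\<close> throughout.
\<close>

definition wnorm :: "('a::complex_hilbert_space \<Rightarrow> 'a) \<Rightarrow> 'a \<Rightarrow> real"
  where "wnorm W x = sqrt (inner (W x) x)"

text \<open>
  This serves twice: with \<open>a\<close> the value of a form it is the Cauchy-Schwarz inequality, and with
  \<open>a\<close> a bound on the distance to an infimum it is the first-order condition at a near minimizer.
\<close>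

lemma quadratic_nonneg_imp_discriminant:
  fixes a b c :: real
  assumes nn: "\<And>t. 0 \<le> a + 2 * t * b + t\<^sup>2 * c" and c: "0 \<le> c"
  shows "\<bar>b\<bar> \<le> sqrt a * sqrt c"
proof (cases "c = 0")
  case True
  have "b = 0"
  proof (rule ccontr)
    assume "b \<noteq> 0"
    then have "2 * (- (a + 1) / (2 * b)) * b = - (a + 1)" by (simp add: field_simps)
    then show False using nn[of "- (a + 1) / (2 * b)"] True by simp
  qed
  then show ?thesis by (simp add: True)
next
  case False
  have "0 \<le> a + 2 * (- b / c) * b + (- b / c)\<^sup>2 * c" by (rule nn)
  also have "\<dots> = a - b\<^sup>2 / c" using False by (simp add: field_simps power2_eq_square)
  finally have "b\<^sup>2 \<le> a * c" using False c by (simp add: field_simps)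
  then have "sqrt (b\<^sup>2) \<le> sqrt (a * c)" by (rule real_sqrt_le_mono)
  then show ?thesis by (simp add: real_sqrt_mult)
qed

lemma wnorm_nonneg: "positive_op W \<Longrightarrow> 0 \<le> wnorm W x"
  by (simp add: wnorm_def positive_op_nonneg)

lemma wnorm_square: "positive_op W \<Longrightarrow> (wnorm W x)\<^sup>2 = inner (W x) x"
  by (simp add: wnorm_def positive_op_nonneg)

lemma wnorm_ii: "positive_op W \<Longrightarrow> wnorm W (\<i> *\<^sub>C x) = wnorm W x"
  by (simp add: wnorm_def bounded_clinear_simps[OF positive_op_clinear] inner_ii scaleC_ii)

lemma quadratic_expand:
  assumes W: "positive_op W"
  shows "inner (W (x + t *\<^sub>R y)) (x + t *\<^sub>R y)
    = inner (W x) x + 2 * t * inner (W x) y + t\<^sup>2 * inner (W y) y"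
  using positive_op_sym[OF W, of y x]
  by (simp add: bounded_clinear_simps[OF positive_op_clinear[OF W]] inner_add_left inner_add_right
      power2_eq_square inner_commute algebra_simps)

lemma wnorm_Cauchy_Schwarz:
  assumes W: "positive_op W"
  shows "\<bar>inner (W x) y\<bar> \<le> wnorm W x * wnorm W y"
  unfolding wnorm_def
  by (rule quadratic_nonneg_imp_discriminant)
    (use positive_op_nonneg[OF W] in \<open>simp_all flip: quadratic_expand[OF W]\<close>)

lemma wnorm_triangle:
  assumes W: "positive_op W"
  shows "wnorm W (x + y) \<le> wnorm W x + wnorm W y"
proof (rule power2_le_imp_le)
  have "(wnorm W (x + y))\<^sup>2 = (wnorm W x)\<^sup>2 + 2 * inner (W x) y + (wnorm W y)\<^sup>2"
    using quadratic_expand[OF W, of x 1 y] by (simp add: wnorm_square[OF W])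
  then show "(wnorm W (x + y))\<^sup>2 \<le> (wnorm W x + wnorm W y)\<^sup>2"
    using wnorm_Cauchy_Schwarz[OF W, of x y] by (simp add: power2_sum)
  show "0 \<le> wnorm W x + wnorm W y" by (simp add: wnorm_nonneg[OF W])
qed

text \<open>
  The second bound is the useful one: convergence in the seminorm of \<open>W\<close> implies norm convergence
  of the images under \<open>W\<close>. It is Cauchy-Schwarz for the form, applied to \<open>x\<close> and \<open>W x\<close>.
\<close>

lemma wnorm_bounds:
  assumes W: "positive_op W"
  shows "\<exists>C\<ge>0. \<forall>x. wnorm W x \<le> C * norm x \<and> norm (W x) \<le> C * wnorm W x"
proof -
  obtain K where K: "0 \<le> K" "\<And>x. norm (W x) \<le> norm x * K"
    using bounded_linear.nonneg_bounded[OF bounded_clinear_bl[OF positive_op_clinear[OF W]]] by blast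
  have 1: "wnorm W x \<le> sqrt K * norm x" for x
  proof (rule power2_le_imp_le)
    have "inner (W x) x \<le> norm (W x) * norm x" by (rule norm_cauchy_schwarz)
    also have "\<dots> \<le> (norm x * K) * norm x" by (intro mult_right_mono K) simp
    also have "\<dots> = K * (norm x)\<^sup>2" by (simp add: power2_eq_square)
    finally show "(wnorm W x)\<^sup>2 \<le> (sqrt K * norm x)\<^sup>2"
      using K(1) by (simp add: wnorm_square[OF W] power_mult_distrib)
  qed (use K in simp)
  have 2: "norm (W x) \<le> sqrt K * wnorm W x" for x
  proof (cases "W x = 0")
    case False
    have "norm (W x) * norm (W x) \<le> wnorm W x * wnorm W (W x)"
      using wnorm_Cauchy_Schwarz[OF W, of x "W x"] by (simp add: dot_square_norm power2_eq_square)
    also have "\<dots> \<le> wnorm W x * (sqrt K * norm (W x))"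
      by (intro mult_left_mono 1 wnorm_nonneg W)
    finally show ?thesis using False by (simp add: mult_ac)
  qed (simp add: wnorm_nonneg[OF W] K)
  show ?thesis using 1 2 K(1) by (intro exI[of _ "sqrt K"]) simp
qed

lemma positive_op_null:
  assumes W: "positive_op W" and "inner (W x) x \<le> 0"
  shows "W x = 0"
proof -
  obtain C where C: "0 \<le> C" "\<And>x. wnorm W x \<le> C * norm x" "\<And>x. norm (W x) \<le> C * wnorm W x"
    using wnorm_bounds[OF W] by blast
  have "inner (W x) x = 0" using assms(2) positive_op_nonneg[OF W, of x] by (rule antisym)
  then have "wnorm W x = 0" by (simp add: wnorm_def)
  then show ?thesis using C(3)[of x] by simp
qed

lemma op_le_antisym:
  assumes "op_le X Y" "op_le Y X"
  shows "X = Y"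
proof
  fix x
  have "inner (Y x - X x) x \<le> 0"
    using positive_op_nonneg[OF assms(2)[unfolded op_le_def], of x] by (simp add: inner_diff_left)
  then have "Y x - X x = 0" by (rule positive_op_null[OF assms(1)[unfolded op_le_def]])
  then show "X x = Y x" by simp
qed

section \<open>Near minimizers and the shorted operator\<close>

text \<open>
  The first-order condition, up to \<open>e\<close>, for \<open>s\<close> to minimize \<open>inner (W (x + s)) (x + s)\<close> over \<open>S\<close>.
  Unlike the condition that this value be close to its infimum, it is linear in the pair
  \<open>(x, s)\<close> up to adding errors, and so the limit operator below is linear for a simple reason.
\<close>

definition near_minimizer ::
    "('a::complex_hilbert_space \<Rightarrow> 'a) \<Rightarrow> 'a set \<Rightarrow> 'a \<Rightarrow> real \<Rightarrow> 'a \<Rightarrow> bool"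
  where "near_minimizer W S x e s \<longleftrightarrow>
    s \<in> S \<and> (\<forall>t\<in>S. \<bar>inner (W (x + s)) t\<bar> \<le> e * wnorm W t)"

lemma near_minimizer_exists:
  assumes W: "positive_op W" and S: "csubspace S" and e: "0 < e"
  obtains s where "near_minimizer W S x e s"
proof -
  let ?q = "\<lambda>s. inner (W (x + s)) (x + s)"
  have bdd: "bdd_below (?q ` S)" by (rule bdd_belowI2[of _ 0]) (rule positive_op_nonneg[OF W])
  \<comment> \<open>An excess of \<open>e\<^sup>2\<close> over the infimum becomes a first-order error of \<open>e\<close> by the discriminant.\<close>
  have "\<exists>z\<in>?q ` S. z < Inf (?q ` S) + e\<^sup>2"
    using csubspaceD(1)[OF S] e by (intro cInf_lessD) auto
  then obtain s where s: "s \<in> S" "?q s < Inf (?q ` S) + e\<^sup>2" by blast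
  have "\<bar>inner (W (x + s)) t\<bar> \<le> sqrt (e\<^sup>2) * sqrt (inner (W t) t)" if t: "t \<in> S" for t
  proof (rule quadratic_nonneg_imp_discriminant)
    fix r :: real
    have "s + r *\<^sub>R t \<in> S" using s t by (simp add: csubspaceD[OF S])
    then have "Inf (?q ` S) \<le> ?q (s + r *\<^sub>R t)" by (intro cInf_lower bdd) blast
    also have "\<dots> = ?q s + 2 * r * inner (W (x + s)) t + r\<^sup>2 * inner (W t) t"
      using quadratic_expand[OF W, of "x + s" r t] by (simp add: add.assoc)
    finally show "0 \<le> e\<^sup>2 + 2 * r * inner (W (x + s)) t + r\<^sup>2 * inner (W t) t"
      using s by linarith
  qed (rule positive_op_nonneg[OF W])
  then have "near_minimizer W S x e s"
    using s e by (simp add: near_minimizer_def wnorm_def)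
  then show ?thesis by (rule that)
qed

lemma near_minimizer_add:
  assumes W: "positive_op W" and S: "csubspace S"
    and "near_minimizer W S x e s" "near_minimizer W S x' e' s'"
  shows "near_minimizer W S (x + x') (e + e') (s + s')"
  unfolding near_minimizer_def
proof (intro conjI ballI)
  show "s + s' \<in> S" using assms by (auto simp: near_minimizer_def intro: csubspaceD)
  fix t assume t: "t \<in> S"
  have "W (x + x' + (s + s')) = W (x + s) + W (x' + s')"
    by (simp add: bounded_clinear_simps[OF positive_op_clinear[OF W]])
  then have "\<bar>inner (W (x + x' + (s + s'))) t\<bar> \<le> \<bar>inner (W (x + s)) t\<bar> + \<bar>inner (W (x' + s')) t\<bar>"
    by (simp add: inner_add_left)
  also have "\<dots> \<le> e * wnorm W t + e' * wnorm W t"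
    using assms t by (intro add_mono) (auto simp: near_minimizer_def)
  finally show "\<bar>inner (W (x + x' + (s + s'))) t\<bar> \<le> (e + e') * wnorm W t"
    by (simp add: distrib_right)
qed

lemma near_minimizer_scaleR:
  assumes W: "positive_op W" and S: "csubspace S" and n: "near_minimizer W S x e s"
  shows "near_minimizer W S (r *\<^sub>R x) (\<bar>r\<bar> * e) (r *\<^sub>R s)"
  unfolding near_minimizer_def
proof (intro conjI ballI)
  show "r *\<^sub>R s \<in> S" using n by (auto simp: near_minimizer_def intro: csubspaceD[OF S])
  fix t assume t: "t \<in> S"
  have "W (r *\<^sub>R x + r *\<^sub>R s) = r *\<^sub>R W (x + s)"
    by (simp add: bounded_clinear_simps[OF positive_op_clinear[OF W]] scaleR_add_right)
  then have "\<bar>inner (W (r *\<^sub>R x + r *\<^sub>R s)) t\<bar> = \<bar>r\<bar> * \<bar>inner (W (x + s)) t\<bar>"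
    by (simp add: abs_mult)
  also have "\<dots> \<le> \<bar>r\<bar> * (e * wnorm W t)"
    using n t by (intro mult_left_mono) (auto simp: near_minimizer_def)
  finally show "\<bar>inner (W (r *\<^sub>R x + r *\<^sub>R s)) t\<bar> \<le> \<bar>r\<bar> * e * wnorm W t"
    by (simp add: mult.assoc)
qed

lemma near_minimizer_ii:
  assumes W: "positive_op W" and S: "csubspace S" and n: "near_minimizer W S x e s"
  shows "near_minimizer W S (\<i> *\<^sub>C x) e (\<i> *\<^sub>C s)"
  unfolding near_minimizer_def
proof (intro conjI ballI)
  show "\<i> *\<^sub>C s \<in> S" using n by (auto simp: near_minimizer_def intro: csubspaceD[OF S])
  fix t assume t: "t \<in> S"
  have "W (\<i> *\<^sub>C x + \<i> *\<^sub>C s) = \<i> *\<^sub>C W (x + s)"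
    by (simp add: bounded_clinear_simps[OF positive_op_clinear[OF W]] scaleC_add_right)
  then have "\<bar>inner (W (\<i> *\<^sub>C x + \<i> *\<^sub>C s)) t\<bar> = \<bar>inner (W (x + s)) (\<i> *\<^sub>C t)\<bar>"
    by (simp add: inner_ii)
  also have "\<dots> \<le> e * wnorm W (\<i> *\<^sub>C t)"
    using n csubspaceD(5)[OF S t] by (auto simp: near_minimizer_def)
  finally show "\<bar>inner (W (\<i> *\<^sub>C x + \<i> *\<^sub>C s)) t\<bar> \<le> e * wnorm W t"
    by (simp add: wnorm_ii[OF W])
qed

lemma near_minimizer_wnorm_le:
  assumes W: "positive_op W" and e: "0 \<le> e" and n: "near_minimizer W S x e s"
  shows "wnorm W s \<le> e + wnorm W x"
proof (cases "wnorm W s = 0")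
  case False
  then have pos: "0 < wnorm W s" using wnorm_nonneg[OF W, of s] by simp
  have "wnorm W s * wnorm W s = inner (W (x + s)) s - inner (W x) s"
    using wnorm_square[OF W, of s]
    by (simp add: bounded_clinear_simps[OF positive_op_clinear[OF W]] inner_add_left power2_eq_square)
  also have "\<dots> \<le> e * wnorm W s + wnorm W x * wnorm W s"
    using n wnorm_Cauchy_Schwarz[OF W, of x s] unfolding near_minimizer_def by (smt (verit))
  also have "\<dots> = (e + wnorm W x) * wnorm W s" by (simp add: distrib_right)
  finally show ?thesis using pos by simp
qed (simp add: wnorm_nonneg[OF W] e)

text \<open>
  The difference of two near minimizers for \<open>x\<close> is a near minimizer for \<open>0\<close>, and testing the
  first-order condition against that difference itself bounds its seminorm.
\<close>

lemma near_minimizers_close: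
  assumes W: "positive_op W" and S: "csubspace S" and "0 \<le> e" "0 \<le> e'"
    and n: "near_minimizer W S x e s" "near_minimizer W S x e' s'"
  shows "wnorm W (s - s') \<le> e + e'"
proof -
  have "near_minimizer W S (x + - x) (e + e') (s + - s')"
    using near_minimizer_add[OF W S n(1) near_minimizer_scaleR[OF W S n(2), of "-1"]] by simp
  from near_minimizer_wnorm_le[OF W _ this] assms show ?thesis
    by (simp add: wnorm_def)
qed

text \<open>
  The restriction to \<open>e \<le> 1\<close> lets error terms of order \<open>e\<^sup>2\<close> be absorbed into the linear one.
\<close>

lemma le_by_small_error:
  fixes a b K :: real
  assumes "\<And>e. 0 < e \<Longrightarrow> e \<le> 1 \<Longrightarrow> a \<le> b + K * e"
  shows "a \<le> b"
proof (rule LIMSEQ_le_const)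
  show "(\<lambda>n. b + K * inverse (real (Suc n))) \<longlonglongrightarrow> b"
    using tendsto_add[OF tendsto_const[of b] tendsto_mult_right_zero[OF LIMSEQ_inverse_real_of_nat, of K]]
    by simp
  show "\<exists>N. \<forall>n\<ge>N. a \<le> b + K * inverse (real (Suc n))"
    by (intro exI[of _ 0] allI impI assms) (auto simp: field_simps)
qed

lemma eq_by_small_error:
  fixes u v :: "'a::real_normed_vector"
  assumes "\<And>e. 0 < e \<Longrightarrow> e \<le> 1 \<Longrightarrow> norm (u - v) \<le> K * e"
  shows "u = v"
  using le_by_small_error[of "norm (u - v)" 0 K] assms by simp

text \<open>
  Near minimizers \<open>s\<close> for \<open>x\<close> need not converge, but they are Cauchy in the seminorm of \<open>W\<close>, and
  therefore the vectors \<open>W (x + s)\<close> converge in norm, at a rate proportional to the error.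
\<close>

lemma limit_value_exists:
  assumes W: "positive_op W" and S: "csubspace S" and C: "\<And>x. norm (W x) \<le> C * wnorm W x" "0 \<le> C"
  shows "\<exists>y. \<forall>e>0. \<forall>s. near_minimizer W S x e s \<longrightarrow> norm (W (x + s) - y) \<le> C * e"
proof -
  note lin = bounded_clinear_simps[OF positive_op_clinear[OF W]]
  have close: "norm (W (x + s) - W (x + s')) \<le> C * (e + e')"
    if "0 < e" "0 < e'" "near_minimizer W S x e s" "near_minimizer W S x e' s'" for e e' s s'
  proof -
    have "W (x + s) - W (x + s') = W (s - s')" by (simp add: lin)
    also have "norm \<dots> \<le> C * wnorm W (s - s')" by (rule C)
    also have "\<dots> \<le> C * (e + e')"
      using near_minimizers_close[OF W S _ _ that(3,4)] that C(2) by (intro mult_left_mono) auto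
    finally show ?thesis .
  qed
  let ?d = "\<lambda>n. inverse (real (Suc n))"
  have "\<exists>s. near_minimizer W S x (?d n) s" for n
    by (rule near_minimizer_exists[OF W S, of "?d n" x]) auto
  then obtain s where s: "\<And>n. near_minimizer W S x (?d n) (s n)" by metis
  have d0: "(\<lambda>n. C * (e + ?d n)) \<longlonglongrightarrow> C * (e + 0)" for e
    by (intro tendsto_intros LIMSEQ_inverse_real_of_nat)
  have "Cauchy (\<lambda>n. W (x + s n))"
  proof (rule metric_CauchyI)
    fix e :: real assume e: "0 < e"
    have "\<forall>\<^sub>F n in sequentially. C * (0 + ?d n) < e / 2"
      by (rule order_tendstoD[OF d0]) (use e in simp)
    then obtain N where N: "\<And>n. n \<ge> N \<Longrightarrow> C * ?d n < e / 2"
      by (auto simp: eventually_sequentially)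
    have "dist (W (x + s m)) (W (x + s n)) < e" if "m \<ge> N" "n \<ge> N" for m n
      using close[OF _ _ s s, of m n] N[OF that(1)] N[OF that(2)]
      by (simp add: dist_norm distrib_left del: of_nat_Suc)
    then show "\<exists>N. \<forall>m\<ge>N. \<forall>n\<ge>N. dist (W (x + s m)) (W (x + s n)) < e" by blast
  qed
  then obtain y where y: "(\<lambda>n. W (x + s n)) \<longlonglongrightarrow> y"
    using Cauchy_convergent convergent_def by blast
  have "norm (W (x + t) - y) \<le> C * e" if "0 < e" "near_minimizer W S x e t" for e t
  proof (rule LIMSEQ_le)
    show "(\<lambda>n. norm (W (x + t) - W (x + s n))) \<longlonglongrightarrow> norm (W (x + t) - y)"
      by (intro tendsto_intros y)
    show "(\<lambda>n. C * (e + ?d n)) \<longlonglongrightarrow> C * e" using d0[of e] by simp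
    show "\<exists>N. \<forall>n\<ge>N. norm (W (x + t) - W (x + s n)) \<le> C * (e + ?d n)"
      using close[OF that(1) _ that(2) s] by auto
  qed
  then show ?thesis by blast
qed

lemma near_minimizer_mono:
  assumes W: "positive_op W" and n: "near_minimizer W S x e s" and e: "e \<le> e'"
  shows "near_minimizer W S x e' s"
  unfolding near_minimizer_def
proof (intro conjI ballI)
  show "s \<in> S" using n by (simp add: near_minimizer_def)
  fix t assume "t \<in> S"
  then have "\<bar>inner (W (x + s)) t\<bar> \<le> e * wnorm W t" using n by (simp add: near_minimizer_def)
  also have "\<dots> \<le> e' * wnorm W t" by (intro mult_right_mono e wnorm_nonneg W)
  finally show "\<bar>inner (W (x + s)) t\<bar> \<le> e' * wnorm W t" .
qed

text \<open>
  \<open>R x\<close> is the limit of \<open>W (x + s)\<close> as \<open>s\<close> runs through ever better near minimizers for \<open>x\<close>. Each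
  property of \<open>R\<close> below is first checked on \<open>W (x + s)\<close> up to a multiple of the error \<open>e\<close>, and the
  error is then sent to \<open>0\<close>. The outcome is that \<open>R\<close> is the shorted operator of \<open>W\<close>, with
  \<open>inner (R x) x\<close> the infimum of \<open>inner (W (x + s)) (x + s)\<close> over \<open>S\<close>.
\<close>

locale near_minimizer_limit =
  fixes W :: "'a::complex_hilbert_space \<Rightarrow> 'a" and S :: "'a set" and C :: real and R :: "'a \<Rightarrow> 'a"
  assumes W: "positive_op W" and S: "csubspace S" and C0: "0 \<le> C"
    and C1: "\<And>x. wnorm W x \<le> C * norm x" and C2: "\<And>x. norm (W x) \<le> C * wnorm W x"
    and R: "\<And>x e s. 0 < e \<Longrightarrow> near_minimizer W S x e s \<Longrightarrow> norm (W (x + s) - R x) \<le> C * e"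
begin

lemmas lin = bounded_clinear_simps[OF positive_op_clinear[OF W]]

lemma limit_add: "R (x + y) = R x + R y"
proof (rule eq_by_small_error[where K = "4 * C"])
  fix e :: real assume e: "0 < e"
  obtain s where s: "near_minimizer W S x e s" by (rule near_minimizer_exists[OF W S e])
  obtain t where t: "near_minimizer W S y e t" by (rule near_minimizer_exists[OF W S e])
  have "R (x + y) - (R x + R y)
      = (W (x + s) - R x) + (W (y + t) - R y) - (W (x + y + (s + t)) - R (x + y))"
    by (simp add: lin)
  also have "norm \<dots> \<le> norm (W (x + s) - R x) + norm (W (y + t) - R y)
      + norm (W (x + y + (s + t)) - R (x + y))"
    by (intro order_trans[OF norm_triangle_ineq4] add_right_mono norm_triangle_ineq)
  also have "\<dots> \<le> C * e + C * e + C * (e + e)"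
    using e by (intro add_mono R s t near_minimizer_add[OF W S]) auto
  finally show "norm (R (x + y) - (R x + R y)) \<le> 4 * C * e" by (simp add: algebra_simps)
qed

lemma limit_scaleR: "R (r *\<^sub>R x) = r *\<^sub>R R x"
proof (rule eq_by_small_error[where K = "C * (\<bar>r\<bar> + 1) + \<bar>r\<bar> * C"])
  fix e :: real assume e: "0 < e"
  obtain s where s: "near_minimizer W S x e s" by (rule near_minimizer_exists[OF W S e])
  have "near_minimizer W S (r *\<^sub>R x) (\<bar>r\<bar> * e) (r *\<^sub>R s)"
    by (rule near_minimizer_scaleR[OF W S s])
  \<comment> \<open>The error bound is raised so that it stays positive when \<open>r = 0\<close>.\<close>
  then have n: "near_minimizer W S (r *\<^sub>R x) ((\<bar>r\<bar> + 1) * e) (r *\<^sub>R s)"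
    by (rule near_minimizer_mono[OF W]) (use e in simp)
  have "R (r *\<^sub>R x) - r *\<^sub>R R x = r *\<^sub>R (W (x + s) - R x) - (W (r *\<^sub>R x + r *\<^sub>R s) - R (r *\<^sub>R x))"
    by (simp add: lin algebra_simps)
  also have "norm \<dots> \<le> norm (r *\<^sub>R (W (x + s) - R x)) + norm (W (r *\<^sub>R x + r *\<^sub>R s) - R (r *\<^sub>R x))"
    by (rule norm_triangle_ineq4)
  also have "\<dots> \<le> \<bar>r\<bar> * (C * e) + C * ((\<bar>r\<bar> + 1) * e)"
    unfolding norm_scaleR using e by (intro add_mono mult_left_mono R s n) auto
  finally show "norm (R (r *\<^sub>R x) - r *\<^sub>R R x) \<le> (C * (\<bar>r\<bar> + 1) + \<bar>r\<bar> * C) * e"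
    by (simp add: algebra_simps)
qed

lemma norm_ii: "norm (\<i> *\<^sub>C (x::'a)) = norm x"
  by (simp add: norm_eq_sqrt_inner inner_ii scaleC_ii)

lemma limit_ii: "R (\<i> *\<^sub>C x) = \<i> *\<^sub>C R x"
proof (rule eq_by_small_error[where K = "2 * C"])
  fix e :: real assume e: "0 < e"
  obtain s where s: "near_minimizer W S x e s" by (rule near_minimizer_exists[OF W S e])
  have "R (\<i> *\<^sub>C x) - \<i> *\<^sub>C R x = \<i> *\<^sub>C (W (x + s) - R x) - (W (\<i> *\<^sub>C x + \<i> *\<^sub>C s) - R (\<i> *\<^sub>C x))"
    by (simp add: lin scaleC_add_right scaleC_diff_right)
  also have "norm \<dots> \<le> norm (\<i> *\<^sub>C (W (x + s) - R x)) + norm (W (\<i> *\<^sub>C x + \<i> *\<^sub>C s) - R (\<i> *\<^sub>C x))"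
    by (rule norm_triangle_ineq4)
  also have "\<dots> \<le> C * e + C * e"
    unfolding norm_ii using e by (intro add_mono R s near_minimizer_ii[OF W S])
  finally show "norm (R (\<i> *\<^sub>C x) - \<i> *\<^sub>C R x) \<le> 2 * C * e" by simp
qed

lemma limit_norm: "norm (R x) \<le> 2 * C * C * norm x"
proof -
  have "norm (R x) \<le> 2 * C * wnorm W x + 2 * C * e" if e: "0 < e" for e
  proof -
    obtain s where s: "near_minimizer W S x e s" by (rule near_minimizer_exists[OF W S e])
    have "norm (R x) \<le> norm (W (x + s)) + norm (W (x + s) - R x)"
      using norm_triangle_ineq4[of "W (x + s)" "W (x + s) - R x"] by simp
    also have "\<dots> \<le> C * wnorm W (x + s) + C * e" by (intro add_mono C2 R e s)
    also have "\<dots> \<le> C * (wnorm W x + (e + wnorm W x)) + C * e"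
      using wnorm_triangle[OF W, of x s] near_minimizer_wnorm_le[OF W _ s] e C0
      by (intro add_right_mono mult_left_mono) auto
    finally show ?thesis by (simp add: algebra_simps)
  qed
  then have "norm (R x) \<le> 2 * C * wnorm W x" by (rule le_by_small_error)
  also have "\<dots> \<le> 2 * C * (C * norm x)" using C0 by (intro mult_left_mono C1) auto
  finally show ?thesis by (simp add: mult.assoc)
qed

lemma limit_clinear: "bounded_clinear R"
proof (rule bounded_clinearI)
  show "bounded_linear R"
    by (rule bounded_linear_intro[where K = "2 * C * C"])
      (use limit_norm in \<open>auto simp: limit_add limit_scaleR mult_ac\<close>)
qed (rule limit_ii)

lemma limit_ortho: "R x \<in> ortho S"
  unfolding ortho_iff_inner[OF S]
proof
  fix t assume t: "t \<in> S"
  have "\<bar>inner (R x) t\<bar> \<le> 0 + (wnorm W t + C * norm t) * e" if e: "0 < e" for e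
  proof -
    obtain s where s: "near_minimizer W S x e s" by (rule near_minimizer_exists[OF W S e])
    have "\<bar>inner (W (x + s) - R x) t\<bar> \<le> norm (W (x + s) - R x) * norm t"
      by (rule Cauchy_Schwarz_ineq2)
    also have "\<dots> \<le> C * e * norm t" by (intro mult_right_mono R e s) simp
    finally have "\<bar>inner (W (x + s) - R x) t\<bar> \<le> C * e * norm t" .
    moreover have "\<bar>inner (W (x + s)) t\<bar> \<le> e * wnorm W t"
      using s t by (auto simp: near_minimizer_def)
    moreover have "inner (R x) t = inner (W (x + s)) t - inner (W (x + s) - R x) t"
      by (simp add: inner_diff_left)
    ultimately have "\<bar>inner (R x) t\<bar> \<le> e * wnorm W t + C * e * norm t" by linarith
    then show ?thesis by (simp add: algebra_simps)
  qed
  then have "\<bar>inner (R x) t\<bar> \<le> 0" by (rule le_by_small_error)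
  then show "inner (R x) t = 0" by simp
qed

text \<open>
  Since \<open>W (x + s)\<close> is almost orthogonal to \<open>S\<close>, the correction \<open>t\<close> may be added to \<open>y\<close> at
  little cost. The right-hand form is symmetric and positive, and so \<open>R\<close> inherits both.
\<close>

lemma limit_form_approx:
  assumes e: "0 < e" "e \<le> 1" and s: "near_minimizer W S x e s" and t: "near_minimizer W S y e t"
  shows "\<bar>inner (R x) y - inner (W (x + s)) (y + t)\<bar> \<le> (C * norm y + 1 + wnorm W y) * e"
proof -
  have "\<bar>inner (W (x + s) - R x) y\<bar> \<le> norm (W (x + s) - R x) * norm y"
    by (rule Cauchy_Schwarz_ineq2)
  also have "\<dots> \<le> C * e * norm y" by (intro mult_right_mono R e s) simp
  finally have 1: "\<bar>inner (W (x + s) - R x) y\<bar> \<le> C * e * norm y" .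
  have "t \<in> S" using t by (simp add: near_minimizer_def)
  then have "\<bar>inner (W (x + s)) t\<bar> \<le> e * wnorm W t" using s by (simp add: near_minimizer_def)
  also have "\<dots> \<le> e * (1 + wnorm W y)"
    using near_minimizer_wnorm_le[OF W _ t] e by (intro mult_left_mono) auto
  finally have 2: "\<bar>inner (W (x + s)) t\<bar> \<le> e * (1 + wnorm W y)" .
  have "inner (R x) y - inner (W (x + s)) (y + t)
      = - inner (W (x + s) - R x) y - inner (W (x + s)) t"
    by (simp add: inner_diff_left inner_add_right)
  then have "\<bar>inner (R x) y - inner (W (x + s)) (y + t)\<bar> \<le> C * e * norm y + e * (1 + wnorm W y)"
    using 1 2 by linarith
  also have "\<dots> = (C * norm y + 1 + wnorm W y) * e" by (simp add: algebra_simps)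
  finally show ?thesis .
qed

lemma limit_sym: "inner (R x) y = inner x (R y)"
proof -
  let ?K = "(C * norm y + 1 + wnorm W y) + (C * norm x + 1 + wnorm W x)"
  have "inner (R x) y = inner (R y) x"
  proof (rule eq_by_small_error)
    fix e :: real assume e: "0 < e" "e \<le> 1"
    obtain s where s: "near_minimizer W S x e s" by (rule near_minimizer_exists[OF W S e(1)])
    obtain t where t: "near_minimizer W S y e t" by (rule near_minimizer_exists[OF W S e(1)])
    have "inner (W (x + s)) (y + t) = inner (W (y + t)) (x + s)"
      using positive_op_sym[OF W, of "x + s" "y + t"] inner_commute[of "x + s" "W (y + t)"]
      by (rule trans)
    then show "norm (inner (R x) y - inner (R y) x) \<le> ?K * e"
      using limit_form_approx[OF e s t] limit_form_approx[OF e t s]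
      unfolding distrib_right[of _ _ e] real_norm_def by linarith
  qed
  then show ?thesis by (simp add: inner_commute)
qed

lemma limit_nonneg: "0 \<le> inner (R x) x"
proof (rule le_by_small_error)
  fix e :: real assume e: "0 < e" "e \<le> 1"
  obtain s where s: "near_minimizer W S x e s" by (rule near_minimizer_exists[OF W S e(1)])
  show "0 \<le> inner (R x) x + (C * norm x + 1 + wnorm W x) * e"
    using limit_form_approx[OF e s s] positive_op_nonneg[OF W, of "x + s"] by linarith
qed

lemma limit_le: "inner (R x) x \<le> inner (W x) x"
proof (rule le_by_small_error)
  fix e :: real assume e: "0 < e" "e \<le> 1"
  obtain s where s: "near_minimizer W S x e s" by (rule near_minimizer_exists[OF W S e(1)])
  have sS: "s \<in> S" using s by (simp add: near_minimizer_def)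
  then have "\<bar>inner (W (x + s)) s\<bar> \<le> e * wnorm W s" using s by (simp add: near_minimizer_def)
  also have "\<dots> \<le> e * (1 + wnorm W x)"
    using near_minimizer_wnorm_le[OF W _ s] e by (intro mult_left_mono) auto
  finally have 1: "\<bar>inner (W (x + s)) s\<bar> \<le> (1 + wnorm W x) * e" by (simp add: mult.commute)
  have 2: "inner (W x) x = inner (W (x + s)) (x + s) - 2 * inner (W (x + s)) s + inner (W s) s"
    using quadratic_expand[OF W, of "x + s" "-1" s] by simp
  have "inner (R x) x \<le> inner (W x) x
      + (C * norm x + 1 + wnorm W x) * e + 2 * ((1 + wnorm W x) * e)"
    using limit_form_approx[OF e s s] 1 2 positive_op_nonneg[OF W, of s] by linarith
  then show "inner (R x) x \<le> inner (W x) x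
      + (C * norm x + 1 + wnorm W x + 2 * (1 + wnorm W x)) * e"
    by (simp add: algebra_simps)
qed

text \<open>
  A competitor \<open>Y\<close> vanishes on \<open>S\<close>, so its form does not change when \<open>x\<close> is replaced by
  \<open>x + s\<close>; there it is dominated by the form of \<open>W\<close>, which is almost the form of \<open>R\<close> at \<open>x\<close>.
\<close>

lemma limit_greatest:
  assumes Y: "Y \<in> shorted_candidates W S"
  shows "inner (Y x) x \<le> inner (R x) x"
proof (rule le_by_small_error)
  have Y0: "positive_op Y" and YW: "positive_op (\<lambda>x. W x - Y x)" and Yr: "range Y \<subseteq> ortho S"
    using Y by (auto simp: shorted_candidates_def op_le_def)
  have orth: "inner (Y z) s = 0" if "s \<in> S" for z s
    using that Yr ortho_iff_inner[OF S] by blast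
  fix e :: real assume e: "0 < e" "e \<le> 1"
  obtain s where s: "near_minimizer W S x e s" by (rule near_minimizer_exists[OF W S e(1)])
  have sS: "s \<in> S" using s by (simp add: near_minimizer_def)
  have "inner (Y (x + s)) (x + s) = inner (Y x) x"
    using quadratic_expand[OF Y0, of x 1 s] orth[OF sS] by simp
  moreover have "inner (Y (x + s)) (x + s) \<le> inner (W (x + s)) (x + s)"
    using positive_op_nonneg[OF YW, of "x + s"] by (simp add: inner_diff_left)
  ultimately show "inner (Y x) x \<le> inner (R x) x + (C * norm x + 1 + wnorm W x) * e"
    using limit_form_approx[OF e s s] by linarith
qed

text \<open>
  For \<open>x\<close> in the \<open>W\<close>-orthogonal complement of \<open>S\<close> the choice \<open>s = 0\<close> is an exact minimizer.
\<close>

lemma limit_eq_weight: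
  assumes x: "x \<in> ortho_wrt W S"
  shows "R x = W x"
proof (rule sym, rule eq_by_small_error)
  fix e :: real assume e: "0 < e"
  have "near_minimizer W S x e 0"
    using x csubspaceD(1)[OF S] e wnorm_nonneg[OF W]
    by (simp add: near_minimizer_def ortho_wrt_iff ortho_iff_inner[OF S])
  from R[OF e this] show "norm (W x - R x) \<le> C * e" by simp
qed

lemma limit_positive: "positive_op R"
  by (rule positive_opI[OF limit_clinear limit_sym limit_nonneg])

lemma limit_candidate: "R \<in> shorted_candidates W S"
proof -
  have "positive_op (\<lambda>x. W x - R x)"
    using positive_op_sym[OF W] limit_sym limit_le
    by (intro positive_opI bounded_clinear_diff positive_op_clinear[OF W] limit_clinear)
      (auto simp: inner_diff_left inner_diff_right)
  then show ?thesis
    using limit_clinear limit_positive limit_ortho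
    by (auto simp: shorted_candidates_def op_le_def)
qed

lemma limit_max:
  assumes Y: "Y \<in> shorted_candidates W S"
  shows "op_le Y R"
proof -
  have Y0: "positive_op Y"
    using Y by (auto simp: shorted_candidates_def op_le_def)
  show ?thesis
    unfolding op_le_def
    using positive_op_sym[OF Y0] limit_sym limit_greatest[OF Y]
    by (intro positive_opI bounded_clinear_diff positive_op_clinear[OF Y0] limit_clinear)
      (auto simp: inner_diff_left inner_diff_right)
qed

lemma limit_eq_shorted: "R = shorted W S"
  unfolding shorted_def
  by (rule sym, rule the_equality)
    (use limit_candidate limit_max op_le_antisym in blast)+

end

lemma shorted_is_near_minimizer_limit:
  assumes W: "positive_op W" and S: "csubspace S"
  shows "\<exists>C. near_minimizer_limit W S C (shorted W S)"
proof -
  obtain C where C: "0 \<le> C" "\<And>x. wnorm W x \<le> C * norm x" "\<And>x. norm (W x) \<le> C * wnorm W x"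
    using wnorm_bounds[OF W] by blast
  obtain R where "\<And>x e s. 0 < e \<Longrightarrow> near_minimizer W S x e s \<Longrightarrow> norm (W (x + s) - R x) \<le> C * e"
    using limit_value_exists[OF W S C(3,1)] by metis
  then interpret near_minimizer_limit W S C R
    using W S C by unfold_locales
  show ?thesis
    using near_minimizer_limit_axioms limit_eq_shorted by auto
qed

lemma shorted_properties:
  assumes W: "positive_op W" and S: "csubspace S"
  shows "positive_op (shorted W S)" and "positive_op (\<lambda>x. W x - shorted W S x)"
    and "shorted W S x \<in> ortho S" and "x \<in> ortho_wrt W S \<Longrightarrow> shorted W S x = W x"
proof -
  obtain C where "near_minimizer_limit W S C (shorted W S)"
    using shorted_is_near_minimizer_limit[OF assms] by blast
  then interpret near_minimizer_limit W S C "shorted W S" .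
  show "positive_op (shorted W S)" by (rule limit_positive)
  show "positive_op (\<lambda>x. W x - shorted W S x)"
    using limit_candidate by (simp add: shorted_candidates_def op_le_def)
  show "shorted W S x \<in> ortho S" by (rule limit_ortho)
  show "x \<in> ortho_wrt W S \<Longrightarrow> shorted W S x = W x" by (rule limit_eq_weight)
qed

text \<open>
  For the weight \<open>W = I\<close> the near minimizers themselves converge, namely to the point of \<open>S\<close>
  nearest to \<open>- x\<close>. The shorted operator of the identity is thus the orthogonal projection onto
  \<open>ortho S\<close>, and the projection theorem comes for free.
\<close>

lemma shorted_ident_mem:
  assumes S: "csubspace S" and cl: "closed S"
  shows "x - shorted (\<lambda>x. x) S x \<in> S"
proof -
  obtain C where "near_minimizer_limit (\<lambda>x. x) S C (shorted (\<lambda>x. x) S)"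
    using shorted_is_near_minimizer_limit[OF positive_op_ident S] by blast
  then interpret near_minimizer_limit "\<lambda>x. x" S C "shorted (\<lambda>x. x) S" .
  have "\<exists>y\<in>S. dist y (x - shorted (\<lambda>x. x) S x) < d" if d: "0 < d" for d
  proof -
    define e where "e = d / (C + 1)"
    have e: "0 < e" using d C0 by (simp add: e_def)
    obtain s where s: "near_minimizer (\<lambda>x. x) S x e s" by (rule near_minimizer_exists[OF W S e])
    have "- s \<in> S" using s csubspaceD[OF S] by (auto simp: near_minimizer_def)
    moreover have "dist (- s) (x - shorted (\<lambda>x. x) S x) \<le> C * e"
      using R[OF e s] by (simp add: dist_norm norm_minus_commute algebra_simps)
    moreover have "C * e < d" using d C0 by (simp add: e_def field_simps)
    ultimately show ?thesis by (meson le_less_trans)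
  qed
  then have "x - shorted (\<lambda>x. x) S x \<in> closure S" by (simp add: closure_approachable)
  then show ?thesis using cl by simp
qed

section \<open>Orthogonal projections, adjoints and generalized inverses\<close>

lemma orthogonal_projection_exists:
  fixes S :: "'a::complex_hilbert_space set"
  assumes S: "csubspace S" and cl: "closed S"
  shows "\<exists>P. bounded_clinear P \<and> (\<forall>x. P x \<in> S) \<and> (\<forall>x. x - P x \<in> ortho S)"
proof (intro exI conjI allI)
  let ?R = "shorted (\<lambda>x. x) S"
  show "bounded_clinear (\<lambda>x. x - ?R x)"
    by (intro positive_op_clinear shorted_properties(2)[OF positive_op_ident S])
  show "x - ?R x \<in> S" for x by (rule shorted_ident_mem[OF S cl])
  show "x - (x - ?R x) \<in> ortho S" for x
    using shorted_properties(3)[OF positive_op_ident S] by simp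
qed

lemma ortho_Int_self: "x \<in> S \<Longrightarrow> x \<in> ortho S \<Longrightarrow> x = 0"
  by (auto simp: ortho_def cinner_eq complex_eq_iff)

text \<open>
  The Riesz representation argument for the functional \<open>\<lambda>x. cinner (T x) y\<close>: a vector orthogonal to
  its kernel represents it after rescaling.
\<close>

lemma adjoint_vector_exists:
  fixes T :: "'a::complex_hilbert_space \<Rightarrow> 'a"
  assumes T: "bounded_clinear T"
  shows "\<exists>z. \<forall>x. cinner (T x) y = cinner x z"
proof -
  note lin = bounded_clinear_simps[OF T]
  let ?K = "{x. cinner (T x) y = 0}"
  have sub: "csubspace ?K"
    by (auto simp: csubspace_def subspace_def lin cinner_add_left cinner_scaleC_left
        scaleC_of_real[symmetric])
  have "?K = {x. inner (T x) y = 0} \<inter> {x. inner (T x) (\<i> *\<^sub>C y) = 0}"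
    by (auto simp: cinner_eq complex_eq_iff)
  moreover have "closed {x. inner (T x) v = 0}" for v
    by (intro closed_Collect_eq continuous_intros linear_continuous_on bounded_clinear_bl T)
  ultimately have cl: "closed ?K" by auto
  obtain P where P: "\<And>x. P x \<in> ?K" "\<And>x. x - P x \<in> ortho ?K"
    using orthogonal_projection_exists[OF sub cl] by blast
  show ?thesis
  proof (cases "\<exists>v. v \<notin> ?K")
    case False
    then show ?thesis by (intro exI[of _ 0]) simp
  next
    case True
    then obtain v where v: "v \<notin> ?K" by blast
    define u where "u = v - P v"
    have u: "u \<in> ortho ?K" unfolding u_def by (rule P)
    define g where "g = cinner (T u) y"
    have g0: "g \<noteq> 0" using v P(1)[of v] by (simp add: g_def u_def lin cinner_diff_left)
    then have u0: "cinner u u \<noteq> 0"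
      by (auto simp: cinner_self g_def lin)
    have "cinner (T x) y = cinner x (cnj (g / cinner u u) *\<^sub>C u)" for x
    proof -
      let ?c = "cinner (T x) y / g"
      have "x - ?c *\<^sub>C u \<in> ?K"
        using g0 by (simp add: lin cinner_diff_left cinner_scaleC_left g_def[symmetric])
      then have "cinner u (x - ?c *\<^sub>C u) = 0" using u by (simp add: ortho_def)
      then have "cinner (x - ?c *\<^sub>C u) u = 0" by (metis cinner_commute complex_cnj_zero)
      then have "cinner x u = ?c * cinner u u" by (simp add: cinner_diff_left cinner_scaleC_left)
      then show ?thesis using g0 u0 by (simp add: cinner_scaleC_right)
    qed
    then show ?thesis by blast
  qed
qed

lemma eq_if_cinner_left: "(\<And>x. cinner x u = cinner x v) \<Longrightarrow> u = v"
  by (metis cinner_diff_right eq_iff_diff_eq_0 inner_eq_zero_iff Re_cinner zero_complex.sel(1))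

lemma adj_unique:
  assumes "\<And>x y. cinner (T x) y = cinner x (U y)"
  shows "adj T = U"
  unfolding adj_def
proof (rule the_equality)
  fix V assume V: "\<forall>x y. cinner (T x) y = cinner x (V y)"
  show "V = U"
  proof (rule ext, rule eq_if_cinner_left)
    show "cinner x (V y) = cinner x (U y)" for x y
      using V assms[of x y] by simp
  qed
qed (use assms in simp)

lemma cinner_adj:
  assumes T: "bounded_clinear T"
  shows "cinner (T x) y = cinner x (adj T y)"
proof -
  obtain U where U: "\<And>x y. cinner (T x) y = cinner x (U y)"
    using adjoint_vector_exists[OF T] by metis
  then show ?thesis using adj_unique[of T U] by simp
qed

lemma cinner_adj': "bounded_clinear T \<Longrightarrow> cinner (adj T x) y = cinner x (T y)"
  by (metis cinner_adj cinner_commute)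

lemma inner_adj: "bounded_clinear T \<Longrightarrow> inner (adj T x) y = inner x (T y)"
  by (metis Re_cinner cinner_adj')

lemma bounded_clinear_adj:
  assumes T: "bounded_clinear T"
  shows "bounded_clinear (adj T)"
proof -
  obtain K where K: "0 \<le> K" "\<And>x. norm (T x) \<le> norm x * K"
    using bounded_linear.nonneg_bounded[OF bounded_clinear_bl[OF T]] by blast
  have add: "adj T (x + y) = adj T x + adj T y" for x y
    by (rule eq_if_cinner_left) (simp add: cinner_adj[OF T, symmetric] cinner_add_right)
  have scale: "adj T (c *\<^sub>C x) = c *\<^sub>C adj T x" for c x
    by (rule eq_if_cinner_left) (simp add: cinner_adj[OF T, symmetric] cinner_scaleC_right)
  have bound: "norm (adj T y) \<le> norm y * K" for y
  proof (cases "adj T y = 0")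
    case False
    have "norm (adj T y) * norm (adj T y) = inner (adj T y) (adj T y)"
      by (simp add: dot_square_norm power2_eq_square)
    also have "\<dots> = inner y (T (adj T y))" by (rule inner_adj[OF T])
    also have "\<dots> \<le> norm y * norm (T (adj T y))" by (rule norm_cauchy_schwarz)
    also have "\<dots> \<le> norm y * (norm (adj T y) * K)" by (intro mult_left_mono K) simp
    finally show ?thesis using False by (simp add: mult_ac)
  qed (use K in simp)
  have "bounded_linear (adj T)"
    by (rule bounded_linear_intro[OF add _ bound])
      (simp add: scale scaleC_of_real[symmetric])
  then show ?thesis using scale by (simp add: bounded_clinear_def)
qed

lemma adj_adj: "bounded_clinear T \<Longrightarrow> adj (adj T) = T"
  by (rule adj_unique) (rule cinner_adj')

lemma adj_compose:
  "bounded_clinear T \<Longrightarrow> bounded_clinear U \<Longrightarrow> adj (T \<circ> U) = adj U \<circ> adj T"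
  by (rule adj_unique) (simp add: cinner_adj)

lemma adj_positive: "positive_op W \<Longrightarrow> adj W = W"
  by (rule adj_unique) (rule positive_op_csym)

lemma bounded_clinear_comp: "bounded_clinear T \<Longrightarrow> bounded_clinear U \<Longrightarrow> bounded_clinear (T \<circ> U)"
  unfolding comp_def by (rule bounded_clinear_compose)

lemma projection_adj: "projection P \<Longrightarrow> projection (adj P)"
  unfolding projection_def by (metis adj_compose bounded_clinear_adj)

lemma projection_complement: "projection P \<Longrightarrow> projection (\<lambda>x. x - P x)"
  by (auto simp: projection_def fun_eq_iff bounded_clinear_simps
      intro: bounded_clinear_diff bounded_clinear_ident)

lemma projection_range_iff: "projection P \<Longrightarrow> x \<in> range P \<longleftrightarrow> P x = x"
  by (auto simp: projection_def fun_eq_iff) (metis rangeI)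

text \<open>
  The Moore-Penrose inverse: project onto the closed range, then choose the preimage orthogonal to
  the nullspace. That preimage is unique, which makes the choice linear, and it is bounded by the
  open mapping theorem.
\<close>

lemma generalized_inverse_exists:
  fixes T :: "'a::complex_hilbert_space \<Rightarrow> 'a"
  assumes T: "bounded_clinear T" and cl: "closed (range T)"
  shows "\<exists>X. bounded_clinear X \<and> (\<forall>x. T (X (T x)) = T x)"
proof -
  note lin = bounded_clinear_simps[OF T]
  obtain P where P: "bounded_clinear P" "\<And>y. P y \<in> range T" "\<And>y. y - P y \<in> ortho (range T)"
    using orthogonal_projection_exists[OF csubspace_range[OF T] cl] by blast
  obtain N where N: "bounded_clinear N" "\<And>x. N x \<in> nullspace T" "\<And>x. x - N x \<in> ortho (nullspace T)"
    using orthogonal_projection_exists[OF csubspace_nullspace[OF T] closed_nullspace[OF T]] by blast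
  note Plin = bounded_clinear_simps[OF P(1)]
  obtain K where K: "0 < K" "\<And>y. y \<in> range T \<Longrightarrow> \<exists>x. T x = y \<and> norm x \<le> K * norm y"
    using closed_range_bounded_preimage[OF bounded_clinear_bl[OF T] cl] by blast
  then obtain g where g: "\<And>y. y \<in> range T \<Longrightarrow> T (g y) = y"
      "\<And>y. y \<in> range T \<Longrightarrow> norm (g y) \<le> K * norm y"
    by metis
  define X where "X y = g (P y) - N (g (P y))" for y
  have XN: "X y \<in> ortho (nullspace T)" for y unfolding X_def by (rule N)
  have TX: "T (X y) = P y" for y
    using N(2) g(1)[OF P(2)] by (simp add: X_def lin nullspace_def)
  have uniq: "x = X y" if "x \<in> ortho (nullspace T)" "T x = P y" for x y
  proof -
    have "x - X y \<in> ortho (nullspace T)"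
      using that(1) XN csubspaceD(3)[OF csubspace_ortho] by blast
    moreover have "x - X y \<in> nullspace T" using that(2) by (simp add: nullspace_def lin TX)
    ultimately have "x - X y = 0" using ortho_Int_self by blast
    then show ?thesis by simp
  qed
  have add: "X (y + z) = X y + X z" for y z
    by (rule uniq[symmetric]) (auto simp: lin TX Plin csubspaceD(2)[OF csubspace_ortho] XN)
  have scaleR: "X (r *\<^sub>R y) = r *\<^sub>R X y" for r y
    by (rule uniq[symmetric]) (auto simp: lin TX Plin csubspaceD(4)[OF csubspace_ortho] XN)
  have ii: "X (\<i> *\<^sub>C y) = \<i> *\<^sub>C X y" for y
    by (rule uniq[symmetric]) (auto simp: lin TX Plin csubspaceD(5)[OF csubspace_ortho] XN)
  obtain KN where KN: "\<And>x. norm (x - N x) \<le> norm x * KN" "0 \<le> KN"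
    using bounded_linear.nonneg_bounded[OF bounded_clinear_bl[OF
          bounded_clinear_diff[OF bounded_clinear_ident N(1)]]] by blast
  obtain KP where KP: "\<And>x. norm (P x) \<le> norm x * KP"
    using bounded_linear.nonneg_bounded[OF bounded_clinear_bl[OF P(1)]] by blast
  have bound: "norm (X y) \<le> norm y * (KP * K * KN)" for y
  proof -
    have "norm (X y) \<le> norm (g (P y)) * KN" unfolding X_def by (rule KN)
    also have "\<dots> \<le> (K * norm (P y)) * KN" by (intro mult_right_mono g P KN)
    also have "\<dots> \<le> (K * (norm y * KP)) * KN"
      using K(1) by (intro mult_right_mono mult_left_mono KP KN) simp
    finally show ?thesis by (simp add: mult_ac)
  qed
  have "bounded_clinear X"
    by (intro bounded_clinearI bounded_linear_intro[OF add scaleR bound] ii)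
  moreover have "T (X (T x)) = T x" for x
  proof -
    have "T x - P (T x) \<in> range T"
      using P(2) csubspaceD(3)[OF csubspace_range[OF T]] by blast
    then have "T x - P (T x) = 0" using P(3) ortho_Int_self by blast
    then show ?thesis by (simp add: TX)
  qed
  ultimately show ?thesis by blast
qed

text \<open>
  A point \<open>y\<close> of the range lies in \<open>T ` S\<close> exactly if some, equivalently every, preimage of it lies
  in \<open>S + nullspace T\<close>. A bounded generalized inverse \<open>X\<close> selects such a preimage continuously.
\<close>

lemma closed_image_if_closed_plus_nullspace:
  fixes T :: "'a::complex_hilbert_space \<Rightarrow> 'a"
  assumes T: "bounded_clinear T" and cl: "closed (range T)"
    and S: "closed (S + nullspace T)"
  shows "closed (T ` S)"
proof -
  note lin = bounded_clinear_simps[OF T]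
  obtain X where X: "bounded_clinear X" "\<And>x. T (X (T x)) = T x"
    using generalized_inverse_exists[OF T cl] by blast
  have "T ` S = range T \<inter> X -` (S + nullspace T)"
  proof (intro equalityI subsetI)
    fix y assume "y \<in> T ` S"
    then obtain s where s: "s \<in> S" "y = T s" by blast
    have "X y - s \<in> nullspace T" using s X by (simp add: nullspace_def lin)
    then have "s + (X y - s) \<in> S + nullspace T" using s by (intro set_plus_intro)
    then show "y \<in> range T \<inter> X -` (S + nullspace T)" using s by simp
  next
    fix y assume y: "y \<in> range T \<inter> X -` (S + nullspace T)"
    then obtain s n where sn: "s \<in> S" "n \<in> nullspace T" "X y = s + n"
      by (auto elim: set_plus_elim)
    have "T (X y) = y" using y X by auto
    then have "y = T s" using sn by (simp add: lin nullspace_def)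
    then show "y \<in> T ` S" using sn by blast
  qed
  moreover have "closed (X -` (S + nullspace T))"
    by (intro closed_vimage S linear_continuous_on bounded_clinear_bl X)
  ultimately show ?thesis using cl by (simp add: closed_Int)
qed

section \<open>Compatibility and the minus order\<close>

text \<open>
  From \<open>Z = P W\<close> one gets \<open>Z = W Q\<close> with \<open>Q = P\<^sup>*\<close> a projection, and then
  \<open>W (I - Q) = W - Z\<close> is selfadjoint, as compatibility requires. But the nullspace of \<open>Q\<close>, which is
  the range of \<open>I - Q\<close>, may be smaller than that of \<open>Z = W Q\<close>: the space
  \<open>range Q \<inter> nullspace W\<close> is missing. Let \<open>N\<close> be the orthogonal projection onto this space. Then
  \<open>F = (I - N) Q\<close> is still a projection with \<open>W F = Z\<close>, and its nullspace is that of \<open>Z\<close>.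
\<close>

lemma minus_le_weight_imp_compatible:
  fixes W Z :: "'a::complex_hilbert_space \<Rightarrow> 'a"
  assumes W: "positive_op W" and Z: "positive_op Z" and le: "minus_le Z W"
  shows "compatible W (nullspace Z)"
proof -
  have Wc: "bounded_clinear W" and Zc: "bounded_clinear Z"
    using W Z by (auto intro: positive_op_clinear)
  obtain P where P: "projection P" "Z = P \<circ> W" using le by (auto simp: minus_le_def)
  have Pc: "bounded_clinear P" using P by (simp add: projection_def)
  define Q where "Q = adj P"
  have Q: "projection Q" unfolding Q_def by (rule projection_adj[OF P(1)])
  then have Qc: "bounded_clinear Q" and QQ: "\<And>x. Q (Q x) = Q x"
    by (auto simp: projection_def fun_eq_iff)
  have "adj Z = W \<circ> Q"
    using adj_compose[OF Pc Wc] by (simp only: P(2) Q_def adj_positive[OF W])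
  then have "Z = W \<circ> Q" by (simp only: adj_positive[OF Z])
  then have WQ: "W (Q x) = Z x" for x by simp
  let ?M = "range Q \<inter> nullspace W"
  have "range Q = nullspace (\<lambda>x. x - Q x)"
    by (rule set_eqI) (simp only: projection_range_iff[OF Q] nullspace_iff, auto)
  then have M: "csubspace ?M" "closed ?M"
    using csubspace_nullspace[OF Wc] csubspace_range[OF Qc] closed_nullspace[OF Wc]
      closed_nullspace[OF bounded_clinear_diff[OF bounded_clinear_ident Qc]]
    by (auto simp: csubspace_def subspace_inter closed_Int)
  obtain N where N: "bounded_clinear N" "\<And>x. N x \<in> ?M" "\<And>x. x - N x \<in> ortho ?M"
    using orthogonal_projection_exists[OF M] by blast
  have NM: "N x = x" if "x \<in> ?M" for x
  proof -
    have "x - N x \<in> ?M" using that N(2) csubspaceD(3)[OF M(1)] by blast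
    then have "x - N x = 0" by (rule ortho_Int_self[OF _ N(3)])
    then show ?thesis by simp
  qed
  have QN: "Q (N x) = N x" for x
    using N(2)[of x] projection_range_iff[OF Q, of "N x"] by blast
  have WN: "W (N x) = 0" for x
    using N(2)[of x] by (simp add: nullspace_iff)
  note lin = bounded_clinear_simps[OF Qc] bounded_clinear_simps[OF N(1)] bounded_clinear_simps[OF Wc]
  define F where "F x = Q x - N (Q x)" for x
  have Fc: "bounded_clinear F"
    unfolding F_def by (intro bounded_clinear_diff Qc bounded_clinear_compose[OF N(1)])
  have FF: "F (F x) = F x" for x by (simp add: F_def lin QQ QN NM[OF N(2)])
  then have F: "projection F" using Fc by (simp add: projection_def fun_eq_iff)
  have WF: "W (F x) = Z x" for x by (simp add: F_def lin WN WQ)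
  have null: "F x = 0 \<longleftrightarrow> Z x = 0" for x
  proof
    assume "F x = 0"
    then show "Z x = 0" using WF[of x] by (simp add: lin)
  next
    assume "Z x = 0"
    then have "Q x \<in> ?M" by (simp add: nullspace_iff WQ)
    then show "F x = 0" by (simp add: F_def NM)
  qed
  let ?G = "\<lambda>x. x - F x"
  have G: "projection ?G" by (rule projection_complement[OF F])
  have Gc: "bounded_clinear ?G" using G by (simp add: projection_def)
  have "range ?G = nullspace Z"
    by (rule set_eqI) (simp only: projection_range_iff[OF G] nullspace_iff, simp add: null)
  moreover have "W \<circ> ?G = adj ?G \<circ> W"
  proof -
    have eq: "W \<circ> ?G = (\<lambda>x. W x - Z x)" by (simp add: fun_eq_iff lin WF)
    have "adj (W \<circ> ?G) = W \<circ> ?G"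
      unfolding eq
      by (rule adj_unique)
        (simp add: cinner_diff_left cinner_diff_right positive_op_csym[OF W] positive_op_csym[OF Z])
    then show ?thesis using adj_compose[OF Wc Gc] by (simp only: adj_positive[OF W])
  qed
  ultimately show ?thesis using G unfolding compatible_def by blast
qed

lemma compatible_complement:
  fixes W Z :: "'a::complex_hilbert_space \<Rightarrow> 'a"
  assumes W: "positive_op W" and Q: "projection Q" and WQ: "W \<circ> Q = adj Q \<circ> W"
  shows "x - Q x \<in> ortho_wrt W (range Q)"
proof -
  have Qc: "bounded_clinear Q" and QQ: "\<And>x. Q (Q x) = Q x"
    using Q by (auto simp: projection_def fun_eq_iff)
  have sym: "W (Q x) = adj Q (W x)" for x using WQ by (metis comp_apply)
  have "cinner (W (x - Q x)) (Q y) = 0" for y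
  proof -
    have "cinner (W (x - Q x)) (Q y) = cinner (adj Q (W (x - Q x))) y" by (simp add: cinner_adj'[OF Qc])
    also have "\<dots> = cinner (W (Q (x - Q x))) y" by (simp add: sym)
    also have "\<dots> = 0"
      by (simp add: bounded_clinear_simps[OF Qc] QQ bounded_clinear_simps[OF positive_op_clinear[OF W]])
    finally show ?thesis .
  qed
  then show ?thesis by (auto simp: ortho_wrt_def)
qed

section \<open>Weighted residuals\<close>

locale weighted_residual_problem =
  fixes A B W :: "'a::complex_hilbert_space \<Rightarrow> 'a"
  assumes A: "bounded_clinear A" and B: "bounded_clinear B" and W: "positive_op W"
    and null_B: "nullspace B = ortho_wrt W (range A)"
begin

abbreviation "Z \<equiv> shorted W (range A)"

lemma weight_clinear: "bounded_clinear W" using W by (rule positive_op_clinear)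

lemma shorted_pos: "positive_op Z" by (rule shorted_properties(1)[OF W csubspace_range[OF A]])

lemma shorted_clinear: "bounded_clinear Z" using shorted_pos by (rule positive_op_clinear)

lemma shorted_null_range: "Z (A x) = 0"
proof -
  have "cinner (Z (A x)) (A x) = 0"
    using shorted_properties(3)[OF W csubspace_range[OF A]] by (auto simp: ortho_def)
  then show ?thesis by (intro positive_op_null[OF shorted_pos]) (simp add: cinner_eq complex_eq_iff)
qed

definition residual :: "('a \<Rightarrow> 'a) \<Rightarrow> 'a \<Rightarrow> 'a"
  where "residual X = (\<lambda>h. A (X (B h)) - h)"

lemma weighted_residuals_eq:
  "weighted_residuals A B W = {adj (residual X) \<circ> W \<circ> residual X | X. bounded_clinear X}"
  by (simp add: weighted_residuals_def residual_def)

lemma residual_clinear: "bounded_clinear X \<Longrightarrow> bounded_clinear (residual X)"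
  unfolding residual_def
  by (intro bounded_clinear_diff bounded_clinear_compose[OF A] bounded_clinear_compose[OF _ B]
      bounded_clinear_ident)

lemma adj_weighted_residual:
  assumes X: "bounded_clinear X"
  shows "adj (adj (residual X) \<circ> W \<circ> residual X) = adj (residual X) \<circ> W \<circ> residual X"
  by (rule adj_unique)
    (simp add: cinner_adj[OF residual_clinear[OF X]] cinner_adj'[OF residual_clinear[OF X]]
      positive_op_csym[OF W])

text \<open>
  \<open>W\<close> itself is the member for \<open>X = 0\<close>, because \<open>(- I)\<^sup>* W (- I) = W\<close>.
\<close>

lemma weight_mem: "W \<in> weighted_residuals A B W"
proof -
  have 0: "residual (\<lambda>x. 0) = (\<lambda>x. - x)"
    by (simp add: residual_def bounded_clinear_simps[OF A])
  have "adj (\<lambda>x::'a. - x) = (\<lambda>x. - x)"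
    by (rule adj_unique) (simp add: cinner_minus_left cinner_minus_right)
  then have "W = adj (residual (\<lambda>x. 0)) \<circ> W \<circ> residual (\<lambda>x. 0)"
    by (simp add: 0 fun_eq_iff bounded_clinear_simps[OF weight_clinear])
  then show ?thesis unfolding weighted_residuals_eq using bounded_clinear_zero by blast
qed

text \<open>
  On \<open>nullspace B\<close> every residual acts as \<open>- I\<close>. As \<open>W\<close> maps this space, which is the
  \<open>W\<close>-orthogonal complement of \<open>range A\<close>, into \<open>ortho (range A)\<close>, the term \<open>A X B\<close> does not
  contribute on the left either; and \<open>W\<close> agrees there with its shorted operator. So all members of
  the set coincide on \<open>nullspace B\<close> with \<open>Z\<close>.
\<close>

lemma weighted_residual_on_nullspace:
  assumes X: "bounded_clinear X" and x: "x \<in> nullspace B"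
  shows "adj (residual X) (W (residual X x)) = Z x"
proof -
  have "B x = 0" using x by (simp add: nullspace_iff)
  then have r: "residual X x = - x"
    by (simp add: residual_def bounded_clinear_simps[OF A] bounded_clinear_simps[OF X])
  have orth: "cinner (W x) (A y) = 0" for y using x null_B by (auto simp: ortho_wrt_def)
  have "adj (residual X) (W (- x)) = W x"
  proof (rule eq_if_cinner_left)
    fix y
    have "cinner (residual X y) (W (- x)) = cinner y (W x) - cinner (A (X (B y))) (W x)"
      by (simp add: residual_def bounded_clinear_simps[OF weight_clinear] cinner_diff_left cinner_diff_right
          cinner_minus_right)
    also have "cinner (A (X (B y))) (W x) = 0"
      using orth by (metis cinner_commute complex_cnj_zero)
    finally show "cinner y (adj (residual X) (W (- x))) = cinner y (W x)"
      by (simp add: cinner_adj[OF residual_clinear[OF X], symmetric])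
  qed
  then show ?thesis
    using x null_B by (simp add: r shorted_properties(4)[OF W csubspace_range[OF A]])
qed

text \<open>
  A witness \<open>Q\<close> of compatibility splits the space: \<open>Q x\<close> lies in the nullspace of \<open>Z\<close> and
  \<open>x - Q x\<close> in the nullspace of \<open>B\<close>, where all the operators in question are known.
\<close>

context
  fixes Q
  assumes Q: "projection Q" "range Q = nullspace Z" "W \<circ> Q = adj Q \<circ> W"
begin

lemma complement_mem: "x - Q x \<in> nullspace B"
proof -
  have "range A \<subseteq> range Q" using Q(2) shorted_null_range by (auto simp: nullspace_iff)
  then show ?thesis
    using compatible_complement[OF W Q(1,3), of x] unfolding null_B ortho_wrt_def by blast
qed

lemma shorted_complement: "Z (x - Q x) = Z x"
proof -
  have "Q x \<in> nullspace Z" using Q(2) by blast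
  then show ?thesis by (simp add: bounded_clinear_simps[OF shorted_clinear] nullspace_iff)
qed

text \<open>
  If \<open>D\<close> is a member of the set and \<open>F = I - Q\<close>, then \<open>D F = Z F = Z\<close>; taking adjoints,
  \<open>Z = F\<^sup>* D\<close>.
\<close>

lemma shorted_minus_le_weighted_residual:
  assumes X: "bounded_clinear X"
  shows "minus_le Z (adj (residual X) \<circ> W \<circ> residual X)"
proof -
  let ?D = "adj (residual X) \<circ> W \<circ> residual X" and ?F = "\<lambda>x. x - Q x"
  have F: "projection ?F" by (rule projection_complement[OF Q(1)])
  then have Fc: "bounded_clinear ?F" by (simp add: projection_def)
  have Dc: "bounded_clinear ?D"
    by (intro bounded_clinear_comp bounded_clinear_adj residual_clinear X weight_clinear)
  have DF: "?D \<circ> ?F = Z"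
    by (rule ext) (simp add: weighted_residual_on_nullspace[OF X complement_mem] shorted_complement)
  have "Z = adj ?F \<circ> ?D"
    using adj_compose[OF Dc Fc] by (simp only: DF adj_weighted_residual[OF X] adj_positive[OF shorted_pos])
  then show ?thesis
    unfolding minus_le_def adj_weighted_residual[OF X] adj_positive[OF shorted_pos]
    using projection_adj[OF F] by blast
qed

text \<open>
  Here \<open>Y = P W\<close> and \<open>Y Q = 0\<close> give \<open>Y = Y (I - Q) = P W (I - Q) = P Z\<close> with the same
  projection \<open>P\<close>, and likewise for the adjoint.
\<close>

lemma minus_le_shorted_if_minus_le_weight:
  assumes Yc: "bounded_clinear Y" and le: "minus_le Y W"
    and null: "nullspace Z \<subseteq> nullspace Y" "nullspace Z \<subseteq> nullspace (adj Y)"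
  shows "minus_le Y Z"
proof -
  obtain P R where P: "projection P" "projection R" "Y = P \<circ> W" "adj Y = R \<circ> W"
    using le by (auto simp: minus_le_def adj_positive[OF W])
  have WF: "W (x - Q x) = Z x" for x
    using shorted_properties(4)[OF W csubspace_range[OF A], of "x - Q x"] complement_mem[of x]
    by (simp add: null_B shorted_complement)
  have Qx: "Q x \<in> nullspace Z" for x using Q(2) by blast
  have YZ: "Y x = P (Z x)" for x
  proof -
    have "Y x = Y (x - Q x)"
      using Qx[of x] null(1) by (auto simp: bounded_clinear_simps[OF Yc] nullspace_iff)
    also have "\<dots> = P (W (x - Q x))" using P(3) by (metis comp_apply)
    finally show ?thesis by (simp only: WF)
  qed
  have aYZ: "adj Y x = R (Z x)" for x
  proof -
    have "adj Y x = adj Y (x - Q x)"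
      using Qx[of x] null(2)
      by (auto simp: bounded_clinear_simps[OF bounded_clinear_adj[OF Yc]] nullspace_iff)
    also have "\<dots> = R (W (x - Q x))" using P(4) by (metis comp_apply)
    finally show ?thesis by (simp only: WF)
  qed
  have "Y = P \<circ> Z" "adj Y = R \<circ> adj Z"
    by (simp_all only: fun_eq_iff comp_apply YZ aYZ adj_positive[OF shorted_pos] simp_thms)
  then show ?thesis unfolding minus_le_def using P(1,2) by blast
qed

end

lemma lower_bound_iff_compatible:
  "minus_lower_bound Z (weighted_residuals A B W) \<longleftrightarrow> compatible W (nullspace Z)"
proof
  assume "minus_lower_bound Z (weighted_residuals A B W)"
  then have "minus_le Z W" using weight_mem by (simp add: minus_lower_bound_def)
  then show "compatible W (nullspace Z)" by (rule minus_le_weight_imp_compatible[OF W shorted_pos])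
next
  assume "compatible W (nullspace Z)"
  then obtain Q where "projection Q" "range Q = nullspace Z" "W \<circ> Q = adj Q \<circ> W"
    by (auto simp: compatible_def)
  from shorted_minus_le_weighted_residual[OF this]
  show "minus_lower_bound Z (weighted_residuals A B W)"
    using shorted_clinear by (auto simp: minus_lower_bound_def weighted_residuals_eq)
qed

text \<open>
  As \<open>range A + nullspace B\<close> is closed, so is \<open>B (range A)\<close>, the range of \<open>B A\<close>. A generalized
  inverse \<open>X\<close> of \<open>B A\<close> sends the residual of a vector of \<open>range A\<close> into
  \<open>nullspace B \<inter> range A\<close>, where a vector is \<open>W\<close>-orthogonal to itself and hence killed by \<open>W\<close>.
\<close>

lemma optimal_residual_exists:
  assumes clB: "closed (range B)" and cl: "closed (range A + ortho_wrt W (range A))"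
  shows "\<exists>X. bounded_clinear X \<and> (\<forall>x. W (residual X (A x)) = 0)"
proof -
  have BA: "bounded_clinear (\<lambda>x. B (A x))" by (rule bounded_clinear_compose[OF B A])
  have "closed (B ` range A)"
    by (rule closed_image_if_closed_plus_nullspace[OF B clB]) (use cl null_B in simp)
  then have "closed (range (\<lambda>x. B (A x)))" by (simp add: image_image)
  then obtain X where X: "bounded_clinear X" "\<And>x. B (A (X (B (A x)))) = B (A x)"
    using generalized_inverse_exists[OF BA] by blast
  have "W (residual X (A x)) = 0" for x
  proof -
    let ?z = "residual X (A x)"
    have "B ?z = 0" by (simp add: residual_def bounded_clinear_simps[OF B] X)
    then have orth: "?z \<in> ortho_wrt W (range A)"
      unfolding null_B[symmetric] nullspace_iff .
    have "?z \<in> range A"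
      unfolding residual_def by (intro csubspaceD(3)[OF csubspace_range[OF A]] rangeI)
    then have "cinner (W ?z) ?z = 0" using orth unfolding ortho_wrt_def by blast
    then show ?thesis by (intro positive_op_null[OF W]) (simp add: cinner_eq complex_eq_iff)
  qed
  then show ?thesis using X by blast
qed

text \<open>
  The range of \<open>U = W R\<close> consists of vectors \<open>W v\<close> that are orthogonal to \<open>range A\<close>; then \<open>v\<close> lies
  in the \<open>W\<close>-orthogonal complement of \<open>range A\<close>, so that \<open>W v = Z v\<close>. Hence \<open>range U\<close> is contained
  in \<open>range Z\<close>, which is the claim after taking orthogonal complements.
\<close>

lemma nullspace_shorted_subset:
  assumes U: "bounded_clinear U" and UW: "U = W \<circ> R" and UA: "\<And>x. adj U (A x) = 0"
  shows "nullspace Z \<subseteq> nullspace (adj U)"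
proof
  fix z assume z: "z \<in> nullspace Z"
  have Ux: "U w = W (R w)" for w by (simp add: UW)
  have "cinner (adj U z) w = 0" for w
  proof -
    have "cinner (W (R w)) (A x) = 0" for x
      using cinner_adj[OF U, of w "A x"] by (simp only: UA Ux cinner_zero_right)
    then have "W (R w) = Z (R w)"
      by (intro shorted_properties(4)[OF W csubspace_range[OF A], symmetric])
        (auto simp: ortho_wrt_def)
    then have "cinner (adj U z) w = cinner z (Z (R w))"
      by (simp only: cinner_adj'[OF U] Ux)
    also have "\<dots> = cinner (Z z) (R w)" by (rule positive_op_csym[OF shorted_pos, symmetric])
    also have "\<dots> = 0" using z by (simp add: nullspace_iff)
    finally show ?thesis .
  qed
  then show "z \<in> nullspace (adj U)" unfolding nullspace_iff by (rule eq_zero_if_cinner)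
qed

text \<open>
  Only two members of the set are used. The one for the optimal \<open>X\<close> vanishes on \<open>range A\<close>, and so
  do \<open>Y\<close> and its adjoint. The one for \<open>X = 0\<close> is \<open>W\<close>, so that both \<open>Y\<close> and its adjoint factor
  through \<open>W\<close> on the left and on the right. Together these make both vanish on the nullspace of
  \<open>Z\<close>, and then a projection that realizes \<open>Y\<close> below \<open>W\<close> also realizes it below \<open>Z\<close>.
\<close>

lemma minus_lower_bound_le_shorted:
  assumes clB: "closed (range B)" and cl: "closed (range A + ortho_wrt W (range A))"
    and comp: "compatible W (nullspace Z)"
    and lb: "minus_lower_bound Y (weighted_residuals A B W)"
  shows "minus_le Y Z"
proof -
  have Y: "bounded_clinear Y" using lb by (simp add: minus_lower_bound_def)
  obtain X where X: "bounded_clinear X" "\<And>x. W (residual X (A x)) = 0"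
    using optimal_residual_exists[OF clB cl] by blast
  let ?D = "adj (residual X) \<circ> W \<circ> residual X"
  have "minus_le Y ?D" using lb X(1) by (auto simp: minus_lower_bound_def weighted_residuals_eq)
  then obtain P R where PR: "projection P" "projection R" "Y = P \<circ> ?D" "adj Y = R \<circ> ?D"
    by (auto simp: minus_le_def adj_weighted_residual[OF X(1)])
  have D0: "?D (A x) = 0" for x
    by (simp add: X(2) bounded_clinear_simps[OF bounded_clinear_adj[OF residual_clinear[OF X(1)]]])
  have YA: "Y (A x) = 0" for x
    using D0[of x] PR(1) fun_cong[OF PR(3), of "A x"]
    by (simp add: projection_def bounded_clinear_simps)
  have YA': "adj Y (A x) = 0" for x
    using D0[of x] PR(2) fun_cong[OF PR(4), of "A x"]
    by (simp add: projection_def bounded_clinear_simps)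
  have le: "minus_le Y W" using lb weight_mem by (simp add: minus_lower_bound_def)
  then obtain P' R' where P': "bounded_clinear P'" "bounded_clinear R'" "Y = P' \<circ> W" "adj Y = R' \<circ> W"
    by (auto simp: minus_le_def adj_positive[OF W] projection_def)
  have "adj Y = W \<circ> adj P'"
    using adj_compose[OF P'(1) weight_clinear] by (simp only: P'(3)[symmetric] adj_positive[OF W])
  from nullspace_shorted_subset[OF bounded_clinear_adj[OF Y] this]
  have 1: "nullspace Z \<subseteq> nullspace Y" using YA by (simp add: adj_adj[OF Y])
  have "Y = W \<circ> adj R'"
    using adj_compose[OF P'(2) weight_clinear]
    by (simp only: P'(4)[symmetric] adj_positive[OF W] adj_adj[OF Y])
  from nullspace_shorted_subset[OF Y this YA']
  have 2: "nullspace Z \<subseteq> nullspace (adj Y)" .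
  obtain Q where "projection Q" "range Q = nullspace Z" "W \<circ> Q = adj Q \<circ> W"
    using comp by (auto simp: compatible_def)
  then show ?thesis by (rule minus_le_shorted_if_minus_le_weight[OF _ _ _ Y le 1 2])
qed

end

theorem proposition4p1:
  fixes A B W :: "'a::complex_hilbert_space \<Rightarrow> 'a"
  assumes "separable_space (euclidean :: 'a topology)"
    and "bounded_clinear A" and "bounded_clinear B"
    and "closed (range A)" and "closed (range B)"
    and "positive_op W"
    and "nullspace B = ortho_wrt W (range A)"
  shows "(minus_lower_bound (shorted W (range A)) (weighted_residuals A B W)
            \<longleftrightarrow> compatible W (nullspace (shorted W (range A))))
       \<and> (compatible W (nullspace (shorted W (range A)))
            \<and> closed (range A + ortho_wrt W (range A))
          \<longrightarrow> is_minus_inf (shorted W (range A)) (weighted_residuals A B W))"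
proof -
  interpret weighted_residual_problem A B W
    using assms by unfold_locales
  show ?thesis
    using lower_bound_iff_compatible minus_lower_bound_le_shorted[OF \<open>closed (range B)\<close>]
    by (auto simp: is_minus_inf_def)
qed

end
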